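(* Let $x,y,z$ be non-negative integers with $x\equiv y\pmod 2$, and let $\mathbf a=(a_1,\dots,a_m)$, $\mathbf b=(b_1,\dots,b_n)$ be two sequences of non-negative integers. Put $a=\sum_i a_i$ and $b=\sum_j b_j$. (a) If $a_1$ is even, then $$M(S^{(1)}_{x,y,z}(\mathbf a;\mathbf b))=2^{y+z+a+b-a_1}\,M\Big(H^{(2)}_{\lfloor x/2\rfloor,\lceil y/2\rceil,z}\big(\tfrac{a_1}{2},a_2,\dots,a_m;\mathbf b\big)\Big)\,M\Big(W^{(1)}_{\lceil x/2\rceil,\lfloor y/2\rfloor,z}\big(\tfrac{a_1}{2},a_2,\dots,a_m;\mathbf b\big)\Big).$$ (b) If $a_1$ is odd, then $$M(S^{(1)}_{x,y,z}(\mathbf a;\mathbf b))=2^{y+z+a+b-a_1}\,M\Big(N^{(4)}_{\lfloor x/2\rfloor,\lceil y/2\rceil,z}\big(\tfrac{a_1+1}{2},a_2,\dots,a_m;\mathbf b\big)\Big)\,M\Big(N^{(1)}_{\lceil x/2\rceil,\lfloor y/2\rfloor,z}\big(\tfrac{a_1-1}{2},a_2,\dots,a_m;\mathbf b\big)\Big).$$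
   Context: Lattice and tilings. For real $u,k$ let $[u;k]$ be the point of the plane with Cartesian coordinates $(u,\frac{\sqrt3}{2}k)$. The triangular lattice has as vertices all $[u;k]$ with $k\in\mathbb Z$, $u-k/2\in\mathbb Z$ (or a horizontal translate of this set by $\frac12$, where needed); its faces are unit equilateral triangles, up-pointing or down-pointing. A region is a finite union of unit triangles. A lozenge is the union of two unit triangles sharing an edge; it is vertical if that edge is horizontal. A tiling of a region is a covering of it by lozenges contained in it, without gaps or overlaps. $M(R)$ is the sum of the weights of all tilings of $R$, the weight of a tiling being the product of the weights of its lozenges; lozenges have weight $1$ unless stated otherwise (so $M(R)$ is the number of tilings of an unweighted $R$); $M(\emptyset)=1$. Sequences. For a sequence $\mathbf a=(a_1,\dots,a_m)$: $a=\sum a_i$, and $o_a,e_a$ are the sums of the $a_i$ with $i$ odd, resp. even; similarly $b,o_b,e_b$ for $\mathbf b=(b_1,\dots,b_n)$. An empty sequence is treated as the one-term sequence $(0)$. The symmetric hexagon with three ferns removed, $S^{(1)}_{x,y,z}(\mathbf a;\mathbf b)$ ($x\equiv y$ mod 2). Let $W=x+y+2a-a_1+2b$ and take the lattice containing $[W/2;0]$. Consider the hexagon, symmetric about the vertical axis $u=0$, with side lengths, clockwise from the north side, $x+2e_a+2e_b$, $y+z+2o_a-a_1+2o_b$, $y+z+2e_a+2e_b$, $x+2o_a-a_1+2o_b$, $y+z+2e_a+2e_b$, $y+z+2o_a-a_1+2o_b$, placed so that its east and west vertices are $[\pm\frac{W+z}{2};-z]$; thus the line $\ell:k=0$, at level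 $z$ above these vertices, meets the hexagon in the segment from $[-\frac W2;0]$ to $[\frac W2;0]$. Remove: the up-pointing triangle of side $a_1$ with base from $[-\frac{a_1}2;0]$ to $[\frac{a_1}2;0]$; for $2\le i\le m$, the triangle of side $a_i$ with a side on $\ell$ from $[\frac{a_1}2+a_2+\dots+a_{i-1};0]$ to $[\frac{a_1}2+a_2+\dots+a_i;0]$ and its mirror image in $u=0$, down-pointing (below $\ell$) if $i$ is even, up-pointing (above $\ell$) if $i$ is odd; for $1\le j\le n$, the triangle of side $b_j$ with a side on $\ell$ from $[\frac W2-b_1-\dots-b_j;0]$ to $[\frac W2-b_1-\dots-b_{j-1};0]$ and its mirror image in $u=0$, up-pointing (above $\ell$) if $j$ is odd, down-pointing (below $\ell$) if $j$ is even. All lozenges have weight $1$. The halved-hexagon regions $X_{x,y,z}(\mathbf a;\mathbf b)$, $X\in\{H^{(2)},W^{(1)},N^{(1)},N^{(4)}\}$ (here $x,y,z,\mathbf a,\mathbf b$ are generic arguments: non-negative integers and sequences of non-negative integers, with $a_1\ge1$ for $N^{(4)}$). Let $L=x+y+a+b$, $h=y+o_a+o_b$, $g=y+z+e_a+e_b$, and $\ell$ the line $k=0$. Each region is determined by integers $A,B\ge-1$ and functions $\alpha,\beta$ as follows. Upper part (empty if $A=-1$): bounded by $\ell$ between $[\alpha(0);0]$ and $[L;0]$, the segment from $[L;0]$ to $[L-\frac A2;A]$, the horizontal north side at height $k=A$, and the west zigzag through $[\alpha(k);k]$, $0\le k\le A$. Lower part (empty if $B=-1$): bounded by $\ell$ between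 $[\beta(0);0]$ and $[L;0]$, the segments from $[L;0]$ to $[L+\frac z2;-z]$ and from there to $[L+z-\frac B2;-B]$, the horizontal south side at $k=-B$, and the west zigzag through $[\beta(k);-k]$, $0\le k\le B$. The region is the union of the two parts (lozenges may cross $\ell$) after removing: (i) from the upper part, everything at points $[u;k]$ with $u<a_1-k/2$; (ii) for $2\le i\le m$, the triangle of side $a_i$ with a side on $\ell$ from $[a_1+\dots+a_{i-1};0]$ to $[a_1+\dots+a_i;0]$, down-pointing (below $\ell$) if $i$ is even, up-pointing (above $\ell$) if $i$ is odd; (iii) for $1\le j\le n$, the triangle of side $b_j$ with a side on $\ell$ from $[L-b_1-\dots-b_j;0]$ to $[L-b_1-\dots-b_{j-1};0]$, up-pointing if $j$ is odd, down-pointing if $j$ is even. Data: - $H^{(2)}$: $A=2h-1$, $B=2g-1$; $\alpha=\beta=0$ at even $k$, $\frac12$ at odd $k$; unweighted. - $W^{(1)}$: $A=2h$, $B=2g$; $\alpha=\beta=0$ at even $k$, $-\frac12$ at odd $k$; every vertical lozenge whose two western (left) sides both lie on the west zigzags (upper or lower) has weight $\frac12$. - $N^{(1)}$: $A=2h+1$, $\alpha=-1$ at even $k$, $-\frac12$ at odd $k$; $B=2g$, $\beta=0$ at even $k$, $-\frac12$ at odd $k$; every vertical lozenge whose two western sides both lie on the upper west zigzag has weight $\frac12$. - $N^{(4)}$ ($a_1\ge1$): $A=2h-2$, $\alpha=1$ at even $k$, $\frac12$ at odd $k$; $B=2g-1$, $\beta=0$ at even $k$, $\frac12$ at odd $k$;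 every vertical lozenge whose two western sides both lie on the lower west zigzag has weight $\frac12$. *)

theory Defs
  imports Complex_Main "HOL-Library.Disjoint_Sets"
begin

section \<open>Unit triangles, lozenges and tilings\<close>

text \<open>Horizontal coordinates are doubled to stay within the integers: the pair \<open>(p, k)\<close> denotes
  the point [p/2; k] of the plane, i.e. the point with Cartesian coordinates (p/2, sqrt 3 * k/2).\<close>

type_synonym point = "int \<times> int"

text \<open>\<open>Up p k\<close> and \<open>Down p k\<close> are the up- and down-pointing unit triangles whose horizontal side
  joins \<open>(p, k)\<close> and \<open>(p + 2, k)\<close>.\<close>

datatype triangle = Up int int | Down int int

fun vertices :: "triangle \<Rightarrow> point set" where
  "vertices (Up p k) = {(p, k), (p + 2, k), (p + 1, k + 1)}"
| "vertices (Down p k) = {(p, k), (p + 2, k), (p + 1, k - 1)}"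

text \<open>The lattice containing [c/2; 0].\<close>

definition lattice :: "int \<Rightarrow> point set" where
  "lattice c = {(p, k). even (p - k - c)}"

text \<open>The unit triangles lying in a polygon. All polygons below are given by their intersection with
  the rows of lattice points; between two consecutive rows each of them is bounded on the left and on
  the right by straight segments, so a unit triangle lies in the polygon if and only if its vertices
  do.\<close>

definition faces_in :: "point set \<Rightarrow> triangle set" where
  "faces_in P = {t. vertices t \<subseteq> P}"

definition is_lozenge :: "triangle set \<Rightarrow> bool" where
  "is_lozenge l \<longleftrightarrow> (\<exists>s t. l = {s, t} \<and> s \<noteq> t \<and> card (vertices s \<inter> vertices t) = 2)"

definition tilings :: "triangle set \<Rightarrow> triangle set set set" where
  "tilings R = {T. partition_on R T \<and> (\<forall>l\<in>T. is_lozenge l)}"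

text \<open>A region together with a weight for each lozenge.\<close>

type_synonym weighted_region = "triangle set \<times> (triangle set \<Rightarrow> real)"

definition M :: "weighted_region \<Rightarrow> real" where
  "M = (\<lambda>(R, w). \<Sum>T\<in>tilings R. \<Prod>l\<in>T. w l)"


section \<open>Sequences\<close>

text \<open>Terms are numbered from 1. Since \<open>entry [] 1 = 0\<close>, the empty sequence is treated as the
  one-term sequence (0).\<close>

definition entry :: "nat list \<Rightarrow> nat \<Rightarrow> nat" where
  "entry a i = (if 1 \<le> i \<and> i \<le> length a then a ! (i - 1) else 0)"

definition odd_sum :: "nat list \<Rightarrow> nat" where
  "odd_sum a = (\<Sum>i | i \<in> {1..length a} \<and> odd i. entry a i)"

definition even_sum :: "nat list \<Rightarrow> nat" where
  "even_sum a = (\<Sum>i | i \<in> {1..length a} \<and> even i. entry a i)"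

text \<open>The partial sum of the first \<open>i\<close> terms.\<close>

definition psum :: "nat list \<Rightarrow> nat \<Rightarrow> int" where
  "psum a i = int (sum_list (take i a))"


section \<open>The symmetric hexagon with three ferns removed\<close>

text \<open>The triangle of side \<open>s\<close> with a side on the line k = 0 from [p/2; 0] to [p/2 + s; 0],
  up-pointing if \<open>i\<close> is odd and down-pointing if \<open>i\<close> is even.\<close>

definition fern_triangle :: "nat \<Rightarrow> int \<Rightarrow> nat \<Rightarrow> triangle set" where
  "fern_triangle i p s =
     (if odd i then faces_in {(q, k). 0 \<le> k \<and> p + k \<le> q \<and> q \<le> p + 2 * int s - k}
      else faces_in {(q, k). k \<le> 0 \<and> p - k \<le> q \<and> q \<le> p + 2 * int s + k})"

text \<open>Reflection in the vertical axis.\<close>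

fun mirror :: "triangle \<Rightarrow> triangle" where
  "mirror (Up p k) = Up (- p - 2) k"
| "mirror (Down p k) = Down (- p - 2) k"

definition S1 :: "nat \<Rightarrow> nat \<Rightarrow> nat \<Rightarrow> nat list \<Rightarrow> nat list \<Rightarrow> weighted_region" where
  "S1 x y z a b = (let
     a1 = int (entry a 1);
     W = int x + int y + 2 * int (sum_list a) - a1 + 2 * int (sum_list b);
     \<comment> \<open>lengths of the northeast/northwest and of the southeast/southwest sides; as the east and west
       vertices are [(W+z)/2; -z] and [-(W+z)/2; -z], the lengths of the north and south sides are
       \<open>W + z - ne\<close> and \<open>W + z - se\<close>, i.e. x + 2 e_a + 2 e_b and x + 2 o_a - a_1 + 2 o_b\<close>
     ne = int y + int z + 2 * int (odd_sum a) - a1 + 2 * int (odd_sum b);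
     se = int y + int z + 2 * int (even_sum a) + 2 * int (even_sum b);
     hexagon = faces_in (lattice W \<inter>
       {(p, k). - int z - se \<le> k \<and> k \<le> - int z + ne \<and> \<bar>p\<bar> + \<bar>k + int z\<bar> \<le> W + int z});
     ferns = (\<Union>i\<in>{2..length a}. fern_triangle i (2 * psum a (i - 1) - a1) (entry a i))
           \<union> (\<Union>j\<in>{1..length b}. fern_triangle j (W - 2 * psum b j) (entry b j))
   in (hexagon - fern_triangle 1 (- a1) (entry a 1) - ferns - mirror ` ferns, \<lambda>l. 1))"


section \<open>The halved hexagons\<close>

text \<open>The zigzag functions are doubled as well: \<open>alt r s\<close> is the function with value r/2 at even k
  and s/2 at odd k.\<close>

definition alt :: "int \<Rightarrow> int \<Rightarrow> int \<Rightarrow> int" where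
  "alt r s k = (if even k then r else s)"

definition halved_L :: "nat \<Rightarrow> nat \<Rightarrow> nat list \<Rightarrow> nat list \<Rightarrow> int" where
  "halved_L x y a b = int x + int y + int (sum_list a) + int (sum_list b)"

definition halved_h :: "nat \<Rightarrow> nat list \<Rightarrow> nat list \<Rightarrow> int" where
  "halved_h y a b = int y + int (odd_sum a) + int (odd_sum b)"

definition halved_g :: "nat \<Rightarrow> nat \<Rightarrow> nat list \<Rightarrow> nat list \<Rightarrow> int" where
  "halved_g y z a b = int y + int z + int (even_sum a) + int (even_sum b)"

text \<open>In the lower part the southeastern boundary goes from [L; 0] to [L + z/2; -z] and then to
  [L + z - B/2; -B]; this is the minimum of the two linear bounds.\<close>

definition halved_region ::
  "nat \<Rightarrow> nat \<Rightarrow> nat \<Rightarrow> nat list \<Rightarrow> nat list \<Rightarrow> int \<Rightarrow> (int \<Rightarrow> int) \<Rightarrow> int \<Rightarrow> (int \<Rightarrow> int) \<Rightarrow> triangle set"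
where
  "halved_region x y z a b A \<alpha> B \<beta> = (let
     L = halved_L x y a b;
     upper = faces_in (lattice 0 \<inter>
       {(p, k). 0 \<le> k \<and> k \<le> A \<and> \<alpha> k \<le> p \<and> p \<le> 2 * L - k});
     cut = faces_in {(p, k). 0 \<le> k \<and> p \<le> 2 * int (entry a 1) - k};
     lower = faces_in (lattice 0 \<inter>
       {(p, k). - B \<le> k \<and> k \<le> 0 \<and> \<beta> (- k) \<le> p \<and> p \<le> min (2 * L - k) (2 * L + 2 * int z + k)});
     ferns = (\<Union>i\<in>{2..length a}. fern_triangle i (2 * psum a (i - 1)) (entry a i))
           \<union> (\<Union>j\<in>{1..length b}. fern_triangle j (2 * L - 2 * psum b j) (entry b j))
   in ((upper - cut) \<union> lower) - ferns)"

text \<open>The unit segments of the upper and of the lower west zigzag, as sets of end points.\<close>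

definition upper_zigzag :: "int \<Rightarrow> (int \<Rightarrow> int) \<Rightarrow> point set set" where
  "upper_zigzag A \<alpha> = {{(\<alpha> k, k), (\<alpha> (k + 1), k + 1)} | k. 0 \<le> k \<and> k < A}"

definition lower_zigzag :: "int \<Rightarrow> (int \<Rightarrow> int) \<Rightarrow> point set set" where
  "lower_zigzag B \<beta> = {{(\<beta> k, - k), (\<beta> (k + 1), - (k + 1))} | k. 0 \<le> k \<and> k < B}"

text \<open>Weight 1/2 for the vertical lozenges both of whose western sides belong to \<open>Z\<close>.\<close>

definition zigzag_weight :: "point set set \<Rightarrow> triangle set \<Rightarrow> real" where
  "zigzag_weight Z l =
     (if \<exists>p k. l = {Up p k, Down p k} \<and>
               {(p, k), (p + 1, k + 1)} \<in> Z \<and> {(p, k), (p + 1, k - 1)} \<in> Z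
      then 1 / 2 else 1)"

definition H2 :: "nat \<Rightarrow> nat \<Rightarrow> nat \<Rightarrow> nat list \<Rightarrow> nat list \<Rightarrow> weighted_region" where
  "H2 x y z a b = (let
     A = 2 * halved_h y a b - 1; \<alpha> = alt 0 1;
     B = 2 * halved_g y z a b - 1; \<beta> = alt 0 1
   in (halved_region x y z a b A \<alpha> B \<beta>, \<lambda>l. 1))"

definition W1 :: "nat \<Rightarrow> nat \<Rightarrow> nat \<Rightarrow> nat list \<Rightarrow> nat list \<Rightarrow> weighted_region" where
  "W1 x y z a b = (let
     A = 2 * halved_h y a b; \<alpha> = alt 0 (- 1);
     B = 2 * halved_g y z a b; \<beta> = alt 0 (- 1)
   in (halved_region x y z a b A \<alpha> B \<beta>, zigzag_weight (upper_zigzag A \<alpha> \<union> lower_zigzag B \<beta>)))"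

definition N1 :: "nat \<Rightarrow> nat \<Rightarrow> nat \<Rightarrow> nat list \<Rightarrow> nat list \<Rightarrow> weighted_region" where
  "N1 x y z a b = (let
     A = 2 * halved_h y a b + 1; \<alpha> = alt (- 2) (- 1);
     B = 2 * halved_g y z a b; \<beta> = alt 0 (- 1)
   in (halved_region x y z a b A \<alpha> B \<beta>, zigzag_weight (upper_zigzag A \<alpha>)))"

text \<open>Intended for sequences with \<open>entry a 1 \<ge> 1\<close>.\<close>

definition N4 :: "nat \<Rightarrow> nat \<Rightarrow> nat \<Rightarrow> nat list \<Rightarrow> nat list \<Rightarrow> weighted_region" where
  "N4 x y z a b = (let
     A = 2 * halved_h y a b - 2; \<alpha> = alt 2 1;
     B = 2 * halved_g y z a b - 1; \<beta> = alt 0 1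
   in (halved_region x y z a b A \<alpha> B \<beta>, zigzag_weight (lower_zigzag B \<beta>)))"


section \<open>Finiteness\<close>

text \<open>All regions are finite, so that the sum defining \<open>M\<close> is a genuine finite sum.\<close>

lemma finite_faces_in:
  assumes "finite P"
  shows "finite (faces_in P)"
proof (rule finite_subset)
  show "faces_in P \<subseteq> (\<lambda>(p, k). Up p k) ` P \<union> (\<lambda>(p, k). Down p k) ` P"
  proof
    fix t assume "t \<in> faces_in P"
    then show "t \<in> (\<lambda>(p, k). Up p k) ` P \<union> (\<lambda>(p, k). Down p k) ` P"
      by (cases t) (force simp: faces_in_def)+
  qed
  show "finite ((\<lambda>(p, k). Up p k) ` P \<union> (\<lambda>(p, k). Down p k) ` P)"
    using assms by simp
qed

lemma finite_tilings:
  assumes "finite R"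
  shows "finite (tilings R)"
proof (rule finite_subset)
  show "tilings R \<subseteq> Pow (Pow R)"
    by (auto simp: tilings_def partition_on_def)
  show "finite (Pow (Pow R))"
    using assms by simp
qed

lemma M_empty: "M ({}, w) = 1"
proof -
  have "tilings {} = {{}}"
    by (auto simp: tilings_def partition_on_def)
  then show ?thesis
    by (simp add: M_def)
qed

lemma finite_S1: "finite (fst (S1 x y z a b))"
proof -
  have *: "finite (faces_in (lattice W \<inter> {(p, k). l \<le> k \<and> k \<le> u \<and> \<bar>p\<bar> + \<bar>k + r\<bar> \<le> c}))"
    for W l u r c :: int
    by (rule finite_faces_in, rule finite_subset[of _ "{- c..c} \<times> {l..u}"]) auto
  show ?thesis
    unfolding S1_def Let_def fst_conv by (intro finite_Diff *)
qed

lemma finite_halved_region: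
  "finite (halved_region x y z a b A (alt e e') B (alt f f'))"
proof -
  have 1: "finite (faces_in (lattice 0 \<inter>
      {(p, k). 0 \<le> k \<and> k \<le> A \<and> alt e e' k \<le> p \<and> p \<le> c - k}))" for c :: int
    by (rule finite_faces_in, rule finite_subset[of _ "{min e e'..c} \<times> {0..A}"])
      (auto simp: alt_def split: if_splits)
  have 2: "finite (faces_in (lattice 0 \<inter>
      {(p, k). - B \<le> k \<and> k \<le> 0 \<and> alt f f' (- k) \<le> p \<and> p \<le> min (c - k) (d + k)}))" for c d :: int
    by (rule finite_faces_in, rule finite_subset[of _ "{min f f'..d} \<times> {- B..0}"])
      (auto simp: alt_def split: if_splits)
  show ?thesis
    unfolding halved_region_def Let_def by (intro finite_Diff finite_UnI 1 2)
qed

end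

theory Submission
  imports Defs
begin

text \<open>
  This is an instance of Ciucu's factorization theorem for symmetric planar bipartite graphs. Regard a
  tiling as a perfect matching \<open>\<mu>\<close> of the unit triangles and superimpose it with its mirror image. Each
  triangle \<open>v\<close> on the axis lies on one cycle of the superposition, this cycle is symmetric and meets the
  axis in exactly one other triangle \<open>w\<close>, and reflecting \<open>\<mu>\<close> along the cycle changes the side of the axis
  to which \<open>v\<close> and \<open>w\<close> are matched. The cycles do not cross, so an even number of axis triangles
  lies between \<open>v\<close> and \<open>w\<close>: of the axis triangles numbered from bottom to top, each such cycle contains
  one of even and one of odd number. Prescribing the sides of all triangles of even number therefore divides
  the number of tilings by 2 for each of them, except that a lozenge lying on the axis is a cycle of its own
  and accounts for a weight 1/2. If the prescribed side depends on the number and the orientation of the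
  triangle in the right way, it determines the sides of the triangles of odd number, too, and the tiling
  falls into tilings of two half regions.

  For the hexagon the side only changes at the central triangle, and only if its side \<open>a\<^sub>1\<close> is odd. The half
  regions agree with the halved hexagons up to rows of forced lozenges along the north and south sides.
\<close>

section \<open>The superposition of a matching with its mirror image\<close>

text \<open>Planarity is used only modulo 2. Measured by \<open>cx\<close> and \<open>strip\<close>,
  the triangles are points of the integer grid and lozenges are unit steps in it. Whether a point is
  enclosed by the eastern part of a cycle is therefore the parity of the number of vertical edges
  that a horizontal ray between two rows crosses, and no curve in the plane has to be considered.
  The grid is bipartite by the parity of the coordinate sum; on the axis, the parity of the strip
  thus stands for the orientation of the triangle. The right way to prescribe sides is a fixed
  parity of rank plus strip: the two axis triangles of a cycle have ranks of opposite parity, and,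
  unless they form a lozenge on the axis, they are matched to the same side exactly if their strips
  have different parity. The hexagon meets the axis in consecutive strips, up to a gap of a_1 strips
  at the central triangle. Rank and strip thus differ by a constant on each side of the gap, and
  these two constants differ by a_1. There are 2(y + z + a + b - a_1) axis triangles, half of them
  of even rank; this is the exponent of 2.\<close>

lemma unit_step_parity:
  fixes a b c d :: int
  assumes "\<bar>a - b\<bar> + \<bar>c - d\<bar> = 1"
  shows "even (b + d) \<longleftrightarrow> odd (a + c)"
proof -
  have "\<bar>a - b\<bar> = 0 \<and> \<bar>c - d\<bar> = 1 \<or> \<bar>a - b\<bar> = 1 \<and> \<bar>c - d\<bar> = 0"
    using assms by linarith
  then have "(b = a \<and> (d = c + 1 \<or> d = c - 1)) \<or> ((b = a + 1 \<or> b = a - 1) \<and> d = c)"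
    by linarith
  then show ?thesis by auto
qed

section \<open>Parity of finite sets under involutions\<close>

lemma even_card_involution:
  assumes "finite S" "\<And>x. x \<in> S \<Longrightarrow> f x \<in> S" "\<And>x. x \<in> S \<Longrightarrow> f (f x) = x" "\<And>x. x \<in> S \<Longrightarrow> f x \<noteq> x"
  shows "even (card S)"
proof -
  have disj: "\<And>c c'. c \<in> (\<lambda>x. {x, f x}) ` S \<Longrightarrow> c' \<in> (\<lambda>x. {x, f x}) ` S \<Longrightarrow> c \<noteq> c' \<Longrightarrow> c \<inter> c' = {}"
  proof -
    fix c c' assume "c \<in> (\<lambda>x. {x, f x}) ` S" "c' \<in> (\<lambda>x. {x, f x}) ` S" "c \<noteq> c'"
    then obtain x y where "x \<in> S" "y \<in> S" "c = {x, f x}" "c' = {y, f y}" by blast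
    moreover have "f (f x) = x" "f (f y) = y" using calculation assms(3) by auto
    ultimately have "{x, f x} = {z, f z}" "{y, f y} = {z, f z}" if "z \<in> c" "z \<in> c'" for z
    proof -
      have "z = x \<or> z = f x" "z = y \<or> z = f y"
        using that \<open>c = {x, f x}\<close> \<open>c' = {y, f y}\<close> by blast+
      then show "{x, f x} = {z, f z}" "{y, f y} = {z, f z}"
        using \<open>f (f x) = x\<close> \<open>f (f y) = y\<close> by (metis insert_commute)+
    qed
    then show "c \<inter> c' = {}"
      using \<open>c \<noteq> c'\<close> \<open>c = {x, f x}\<close> \<open>c' = {y, f y}\<close> by blast
  qed
  have "2 * card ((\<lambda>x. {x, f x}) ` S) = card (\<Union> ((\<lambda>x. {x, f x}) ` S))"
  proof (rule card_partition)
    show "\<And>c. c \<in> (\<lambda>x. {x, f x}) ` S \<Longrightarrow> card c = 2"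
      using assms(4) by (metis (no_types, lifting) card_2_iff imageE)
  qed (use assms disj in auto)
  moreover have "\<Union> ((\<lambda>x. {x, f x}) ` S) = S" using assms by auto
  ultimately show ?thesis by (metis dvd_triv_left)
qed

text \<open>Elements whose partner stays in \<open>U\<close> pair off. Applied to two matchings and
  the same \<open>U\<close>, this says that the edges of both matchings that leave \<open>U\<close>
  are even in number altogether: a closed curve crosses a boundary evenly often.\<close>

lemma card_exits_parity:
  assumes "finite U" "\<And>x. x \<in> U \<Longrightarrow> f (f x) = x" "\<And>x. x \<in> U \<Longrightarrow> f x \<noteq> x"
  shows "even (card {x \<in> U. f x \<notin> U}) \<longleftrightarrow> even (card U)"
proof -
  have "even (card {x \<in> U. f x \<in> U})"
    by (rule even_card_involution[where f = f]) (use assms in auto)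
  moreover have "card U = card {x \<in> U. f x \<in> U} + card {x \<in> U. f x \<notin> U}"
    using assms(1) by (subst card_Un_disjoint[symmetric]) (auto intro: arg_cong[where f = card])
  ultimately show ?thesis by simp
qed

text \<open>Planarity is encoded by coordinates: the vertices sit at distinct points of the integer
  grid and matched vertices at neighbouring points, so that the edges of a matching and of its
  mirror image cannot cross.\<close>

locale mirrored_matching =
  fixes R :: "'a set" and X Y :: "'a \<Rightarrow> int" and \<sigma> \<mu> :: "'a \<Rightarrow> 'a"
  assumes finite_R: "finite R"
    and coord_inj: "\<lbrakk>s \<in> R; t \<in> R; X s = X t; Y s = Y t\<rbrakk> \<Longrightarrow> s = t"
    and sigma_in [simp]: "t \<in> R \<Longrightarrow> \<sigma> t \<in> R"
    and X_sigma [simp]: "t \<in> R \<Longrightarrow> X (\<sigma> t) = - X t"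
    and Y_sigma [simp]: "t \<in> R \<Longrightarrow> Y (\<sigma> t) = Y t"
    and mu_in [simp]: "t \<in> R \<Longrightarrow> \<mu> t \<in> R"
    and mu_mu [simp]: "t \<in> R \<Longrightarrow> \<mu> (\<mu> t) = t"
    and mu_step: "t \<in> R \<Longrightarrow> \<bar>X t - X (\<mu> t)\<bar> + \<bar>Y t - Y (\<mu> t)\<bar> = 1"
begin

definition nu :: "'a \<Rightarrow> 'a" where "nu t = \<sigma> (\<mu> (\<sigma> t))"

definition axis :: "'a set" where "axis = {t \<in> R. X t = 0}"

definition rank :: "'a \<Rightarrow> nat" where "rank v = card {u \<in> axis. Y u < Y v}"

text \<open>Both \<open>\<mu>\<close> and \<open>nu\<close> are involutions on \<open>R\<close>, so
  such an orbit is a cycle of the superposition, or a single edge that belongs to both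
  matchings.\<close>

inductive_set comp :: "'a \<Rightarrow> 'a set" for v where
  base: "v \<in> comp v"
| mu: "t \<in> comp v \<Longrightarrow> \<mu> t \<in> comp v"
| nu: "t \<in> comp v \<Longrightarrow> nu t \<in> comp v"

lemma sigma_sigma [simp]: "t \<in> R \<Longrightarrow> \<sigma> (\<sigma> t) = t"
  by (rule coord_inj) auto

lemma sigma_axis: "t \<in> axis \<Longrightarrow> \<sigma> t = t"
  unfolding axis_def by (rule coord_inj) auto

lemma nu_in [simp]: "t \<in> R \<Longrightarrow> nu t \<in> R"
  by (simp add: nu_def)

lemma nu_nu [simp]: "t \<in> R \<Longrightarrow> nu (nu t) = t"
  by (simp add: nu_def)

lemma nu_step: "t \<in> R \<Longrightarrow> \<bar>X t - X (nu t)\<bar> + \<bar>Y t - Y (nu t)\<bar> = 1"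
  using mu_step[of "\<sigma> t"] by (simp add: nu_def)

lemma sigma_mu: "t \<in> R \<Longrightarrow> \<sigma> (\<mu> t) = nu (\<sigma> t)"
  by (simp add: nu_def)

lemma sigma_nu: "t \<in> R \<Longrightarrow> \<sigma> (nu t) = \<mu> (\<sigma> t)"
  by (simp add: nu_def)

text \<open>Hence the two edges at an axis point are mirror images of each other: they leave on
  opposite sides, or they coincide and run along the axis.\<close>

lemma nu_axis: "t \<in> axis \<Longrightarrow> nu t = \<sigma> (\<mu> t)"
  by (simp add: nu_def sigma_axis)

lemma axis_in_R: "t \<in> axis \<Longrightarrow> t \<in> R"
  by (simp add: axis_def)

lemma mu_neq: "t \<in> R \<Longrightarrow> \<mu> t \<noteq> t"
  using mu_step[of t] by auto

lemma nu_neq: "t \<in> R \<Longrightarrow> nu t \<noteq> t"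
  using nu_step[of t] by auto

lemma comp_subset: "v \<in> R \<Longrightarrow> t \<in> comp v \<Longrightarrow> t \<in> R"
  by (rotate_tac, induction rule: comp.induct) auto

lemma comp_trans: "t \<in> comp u \<Longrightarrow> u \<in> comp v \<Longrightarrow> t \<in> comp v"
  by (induction rule: comp.induct) (auto intro: comp.intros)

lemma comp_sym:
  assumes "v \<in> R" "t \<in> comp v" shows "v \<in> comp t"
  using assms(2)
proof (induction rule: comp.induct)
  case base show ?case by (rule comp.base)
next
  case (mu t)
  have "t \<in> comp (\<mu> t)" using comp.mu[OF comp.base, of "\<mu> t"] comp_subset[OF assms(1) mu(1)] by simp
  then show ?case using mu comp_trans by blast
next
  case (nu t)
  have "t \<in> comp (nu t)" using comp.nu[OF comp.base, of "nu t"] comp_subset[OF assms(1) nu(1)] by simp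
  then show ?case using nu comp_trans by blast
qed

lemma comp_mu_iff: "v \<in> R \<Longrightarrow> t \<in> R \<Longrightarrow> \<mu> t \<in> comp v \<longleftrightarrow> t \<in> comp v"
  by (metis comp.mu mu_mu)

text \<open>The reflection exchanges \<open>\<mu>\<close> and \<open>nu\<close> and fixes
  \<open>v\<close>.\<close>

lemma sigma_comp: 
  assumes "v \<in> axis" "t \<in> comp v" shows "\<sigma> t \<in> comp v"
  using assms(2)
proof (induction rule: comp.induct)
  case base show ?case using assms by (simp add: sigma_axis comp.base)
next
  case (mu t)
  then show ?case using comp_subset[OF axis_in_R[OF assms(1)] mu(1)] by (simp add: sigma_mu comp.nu)
next
  case (nu t)
  then show ?case using comp_subset[OF axis_in_R[OF assms(1)] nu(1)] by (simp add: sigma_nu comp.mu)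
qed

section \<open>Alternating walks and their first return to the axis\<close>

primrec path :: "bool \<Rightarrow> 'a \<Rightarrow> nat \<Rightarrow> 'a" where
  "path b v 0 = v"
| "path b v (Suc i) = (if even i = b then \<mu> else nu) (path b v i)"

lemma path_in_comp: "path b v i \<in> comp v"
  by (induction i) (auto intro: comp.intros)

lemma path_in_R: "v \<in> R \<Longrightarrow> path b v i \<in> R"
  using path_in_comp comp_subset by blast

lemma path_pred: "v \<in> R \<Longrightarrow> path b v i = (if even i = b then \<mu> else nu) (path b v (Suc i))"
  by (simp add: path_in_R)

lemma path_prev:
  "v \<in> R \<Longrightarrow> i > 0 \<Longrightarrow> (if odd i = b then \<mu> else nu) (path b v i) = path b v (i - 1)"
  by (cases i) (auto simp: path_in_R)

lemma path_step:
  "v \<in> R \<Longrightarrow> \<bar>X (path b v i) - X (path b v (Suc i))\<bar> + \<bar>Y (path b v i) - Y (path b v (Suc i))\<bar> = 1"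
  using mu_step nu_step path_in_R by simp

lemma path_parity:
  assumes "v \<in> R"
  shows "even (X (path b v i) + Y (path b v i)) \<longleftrightarrow> (even i \<longleftrightarrow> even (X v + Y v))"
proof (induction i)
  case (Suc i)
  then show ?case using unit_step_parity[OF path_step[OF assms, of b i]] by simp blast
qed simp

text \<open>Each step can be undone, so a repetition moves back to the start; as \<open>d\<close> is
  even, both positions undo the same matching.\<close>

lemma path_shift:
  assumes "v \<in> R" "even d" "path b v (i + d) = path b v i"
  shows "path b v d = v"
  using assms(3)
proof (induction i)
  case (Suc i)
  have "path b v (i + d) = (if even (i + d) = b then \<mu> else nu) (path b v (Suc (i + d)))"
    by (rule path_pred[OF assms(1)])
  also have "\<dots> = (if even i = b then \<mu> else nu) (path b v (Suc i))"
    using Suc.prems assms(2) by (simp only: add_Suc even_add) simp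
  also have "\<dots> = path b v i"
    by (rule path_pred[OF assms(1), symmetric])
  finally show ?case by (rule Suc.IH)
qed simp

lemma path_return:
  assumes "v \<in> R"
  obtains n where "n > 0" "path b v n = v"
proof -
  \<comment> \<open>Only even positions are compared, because \<open>path_shift\<close> needs a
    repetition at even distance.\<close>
  have "\<not> inj_on (\<lambda>i. path b v (2 * i)) (UNIV :: nat set)"
  proof
    assume "inj_on (\<lambda>i. path b v (2 * i)) (UNIV :: nat set)"
    then have "infinite (range (\<lambda>i. path b v (2 * i)))"
      using finite_imageD infinite_UNIV_nat by blast
    moreover have "range (\<lambda>i. path b v (2 * i)) \<subseteq> R" using assms path_in_R by auto
    ultimately show False using finite_R finite_subset by blast
  qed
  then obtain i j where "path b v (2 * i) = path b v (2 * j)" "i < j"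
    unfolding inj_on_def by (metis UNIV_I nat_neq_iff)
  then have "path b v (2 * i + 2 * (j - i)) = path b v (2 * i)"
    by (simp add: right_diff_distrib')
  then have "path b v (2 * (j - i)) = v"
    using assms path_shift by (metis dvd_triv_left)
  then show ?thesis using that[of "2 * (j - i)"] \<open>i < j\<close> by simp
qed

text \<open>The flag \<open>b\<close> says whether the walk starts with \<open>\<mu>\<close>, and
  its choice makes the walk leave \<open>v\<close> eastwards. It returns to the axis from the east,
  by an edge of \<open>\<mu>\<close> or of \<open>nu\<close> according to the parity of its length
  \<open>n\<close>. As the grid is bipartite and both ends have \<open>X = 0\<close>, this is the
  parity of the sum of their \<open>Y\<close>.\<close>

lemma first_return:
  assumes v: "v \<in> axis" and nz: "X (\<mu> v) \<noteq> 0"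
  defines "b \<equiv> X (\<mu> v) > 0"
  shows "\<exists>n > 0. path b v n \<in> axis \<and> path b v n \<noteq> v \<and>
    (\<forall>i. 0 < i \<and> i < n \<longrightarrow> X (path b v i) > 0) \<and>
    ((X (\<mu> (path b v n)) > 0 \<longleftrightarrow> b) \<longleftrightarrow> odd (Y v + Y (path b v n))) \<and>
    X (\<mu> (path b v n)) \<noteq> 0"
proof -
  have vR: "v \<in> R" and Xv: "X v = 0" using v by (auto simp: axis_def)
  let ?P = "\<lambda>n. n > 0 \<and> X (path b v n) = 0"
  define n where "n = (LEAST n. ?P n)"
  obtain m where "?P m" using path_return[OF vR] Xv by metis
  then have n: "n > 0" "X (path b v n) = 0" unfolding n_def by (metis (mono_tags, lifting) LeastI)+
  have least: "X (path b v i) \<noteq> 0" if "0 < i" "i < n" for i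
    using that not_less_Least unfolding n_def by blast
  have p1: "X (path b v 1) > 0"
    using nz v vR by (auto simp: b_def nu_axis)
  have pos: "X (path b v i) > 0" if "0 < i" "i < n" for i
    using that
  proof (induction i)
    case (Suc i)
    show ?case
    proof (cases "i = 0")
      case False
      then show ?thesis using Suc least[of "Suc i"] path_step[OF vR, of b i] by auto
    qed (use p1 in simp)
  qed simp
  have n2: "n \<ge> 2"
    using n p1 by (cases "n = 1") auto
  then have last: "X (path b v (n - 1)) > 0" using pos by simp
  define w where "w = path b v n"
  have wR: "w \<in> R" unfolding w_def using vR by (rule path_in_R)
  have w: "w \<in> axis" using n wR by (simp add: w_def axis_def)
  have bk: "path b v (n - 1) = (if odd n = b then \<mu> else nu) w"
    using path_prev[OF vR, of n b] n by (simp only: w_def)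
  have side: "X (\<mu> w) > 0 \<longleftrightarrow> (odd n \<longleftrightarrow> b)" "X (\<mu> w) \<noteq> 0"
    using last[unfolded bk] w wR by (auto simp: nu_axis split: if_splits)
  have par: "odd (Y v + Y w) \<longleftrightarrow> odd n"
    using path_parity[OF vR, of b n] n Xv by (auto simp: w_def)
  \<comment> \<open>A closed walk would have even length and arrive by the other matching than the
    one it left by, although only one of the two edges at \<open>v\<close> goes east.\<close>
  have "w \<noteq> v"
  proof
    assume "w = v"
    then have "even n" using par by simp
    then show False using side \<open>w = v\<close> by (auto simp: b_def)
  qed
  then show ?thesis
    using n w pos side par unfolding w_def by (intro exI[of _ n]) blast
qed

lemma comp_subsetI:
  assumes "v \<in> S" "\<And>t. t \<in> S \<Longrightarrow> \<mu> t \<in> S" "\<And>t. t \<in> S \<Longrightarrow> nu t \<in> S"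
  shows "comp v \<subseteq> S"
proof
  fix t assume "t \<in> comp v"
  then show "t \<in> S" by induction (use assms in auto)
qed

text \<open>The eastern arc \<open>P\<close> and its mirror image are together closed under both
  matchings and so contain the component: at either end of the arc, the edge that it lacks is the
  mirror image of the one that it has.\<close>

lemma comp_axis:
  assumes v: "v \<in> axis"
  obtains w n b where "w \<in> axis" "w \<noteq> v" "comp v \<inter> axis = {v, w}" "path b v n = w"
    "\<And>i. i \<le> n \<Longrightarrow> X (path b v i) \<ge> 0"
    "X (\<mu> v) \<noteq> 0 \<Longrightarrow> X (\<mu> w) \<noteq> 0"
    "X (\<mu> v) \<noteq> 0 \<Longrightarrow> (X (\<mu> w) > 0 \<longleftrightarrow> X (\<mu> v) > 0) \<longleftrightarrow> odd (Y v + Y w)"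
proof (cases "X (\<mu> v) = 0")
  \<comment> \<open>An edge along the axis belongs to both matchings and is a component of its
    own.\<close>
  case True
  have vR: "v \<in> R" and Xv: "X v = 0" using v by (auto simp: axis_def)
  have w: "\<mu> v \<in> axis" using True vR by (simp add: axis_def)
  then have nu: "nu v = \<mu> v" "nu (\<mu> v) = v"
    using nu_axis[OF v] nu_axis[OF w] sigma_axis[OF v] sigma_axis[OF w] vR by auto
  have "comp v \<subseteq> {v, \<mu> v}"
    by (rule comp_subsetI) (use nu vR in auto)
  then have "comp v \<inter> axis = {v, \<mu> v}"
    using v w by (auto intro: comp.intros)
  moreover have "X (path True v i) \<ge> 0" if "i \<le> 1" for i
    using that Xv True by (auto simp: le_Suc_eq)
  ultimately show ?thesis
    using w True mu_neq[OF vR] that[of "\<mu> v" True 1] by auto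
next
  case False
  have vR: "v \<in> R" and Xv: "X v = 0" using v by (auto simp: axis_def)
  define b where "b \<longleftrightarrow> X (\<mu> v) > 0"
  obtain n where n: "n > 0" and w: "path b v n \<in> axis" "path b v n \<noteq> v"
    and pos: "\<And>i. 0 < i \<Longrightarrow> i < n \<Longrightarrow> X (path b v i) > 0"
    and side: "(X (\<mu> (path b v n)) > 0 \<longleftrightarrow> b) \<longleftrightarrow> odd (Y v + Y (path b v n))"
    "X (\<mu> (path b v n)) \<noteq> 0"
    using first_return[OF v False, folded b_def] by blast
  let ?c = "path b v"
  define P where "P = ?c ` {..n}"
  have PR: "P \<subseteq> R" using path_in_R[OF vR] by (auto simp: P_def)
  have stepP: "\<mu> t \<in> P \<union> \<sigma> ` P \<and> nu t \<in> P \<union> \<sigma> ` P" if tP: "t \<in> P" for t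
  proof -
    obtain i where i: "i \<le> n" "t = ?c i" using tP unfolding P_def by blast
    have tR: "t \<in> R" using tP PR by blast
    have next': "(if even i = b then \<mu> else nu) t \<in> P" if "i < n"
    proof -
      have "?c (Suc i) \<in> P" unfolding P_def using that by (intro imageI) simp
      then show ?thesis by (simp add: i(2))
    qed
    have prev: "(if even i = b then nu else \<mu>) t \<in> P" if "i > 0"
    proof -
      have "(if even i = b then nu else \<mu>) t = ?c (i - 1)"
        using path_prev[OF vR that, of b] unfolding i(2) by (cases "even i"; cases b) (simp_all only: simp_thms if_True if_False)
      moreover have "?c (i - 1) \<in> P" unfolding P_def using i(1) by (intro imageI) simp
      ultimately show ?thesis by (simp only:)
    qed
    have flip: "nu t = \<sigma> (\<mu> t)" "\<mu> t = \<sigma> (nu t)" if "i = 0 \<or> i = n"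
      using that i v w nu_axis[of t] tR by auto
    show ?thesis
    proof (cases "i = 0 \<or> i = n")
      case True
      have "\<mu> t \<in> P \<or> nu t \<in> P"
        using next' prev n True by (cases "i = 0"; cases "even i = b") simp_all
      then show ?thesis using flip[OF True] by (metis UnCI imageI)
    next
      case False
      then have "i < n" "i > 0" using i(1) by auto
      then show ?thesis using next' prev by (cases "even i = b") simp_all
    qed
  qed
  have "comp v \<subseteq> P \<union> \<sigma> ` P"
  proof (rule comp_subsetI)
    show "v \<in> P \<union> \<sigma> ` P" unfolding P_def using imageI[of 0 "{..n}" ?c] by simp
    have inv: "\<sigma> s \<in> P \<union> \<sigma> ` P" if "s \<in> P \<union> \<sigma> ` P" for s
      using that PR by auto
    show "\<mu> t \<in> P \<union> \<sigma> ` P" "nu t \<in> P \<union> \<sigma> ` P" if "t \<in> P \<union> \<sigma> ` P" for t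
    proof -
      consider "t \<in> P" | s where "s \<in> P" "t = \<sigma> s" using \<open>t \<in> P \<union> \<sigma> ` P\<close> by blast
      then have "\<mu> t \<in> P \<union> \<sigma> ` P \<and> nu t \<in> P \<union> \<sigma> ` P"
      proof cases
        case 2
        then have "s \<in> R" using PR by blast
        then show ?thesis
          using stepP[OF 2(1)] inv[of "\<mu> s"] inv[of "nu s"] by (simp add: 2(2) sigma_mu sigma_nu)
      qed (use stepP in blast)
      then show "\<mu> t \<in> P \<union> \<sigma> ` P" "nu t \<in> P \<union> \<sigma> ` P" by auto
    qed
  qed
  moreover have "t \<in> {v, ?c n}" if "t \<in> P \<union> \<sigma> ` P" "t \<in> axis" for t
  proof -
    have "t \<in> P" using that PR sigma_axis[OF that(2)]
      by (metis Un_iff imageE sigma_sigma subsetD)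
    then obtain i where "i \<le> n" "t = ?c i" unfolding P_def by blast
    then show ?thesis using pos[of i] that(2) by (cases "i = 0"; cases "i = n") (auto simp: axis_def)
  qed
  ultimately have "comp v \<inter> axis = {v, ?c n}"
    using v w by (auto intro: comp.base path_in_comp)
  moreover have "X (?c i) \<ge> 0" if "i \<le> n" for i
    using pos[of i] that Xv w(1) by (cases "i = 0"; cases "i = n") (auto simp: axis_def)
  ultimately show ?thesis
    using that[of "?c n" b n] w side by (auto simp: b_def)
qed

section \<open>Enclosure by a component, modulo 2\<close>

lemma finite_comp: "v \<in> R \<Longrightarrow> finite (comp v)"
  by (meson comp_subset finite_R finite_subset subsetI)

text \<open>Modulo 2, this replaces the Jordan curve theorem: for \<open>s' = s + 1\<close> and \<open>(p, s)\<close> not on \<open>C\<close> it tells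
  whether \<open>(p, s)\<close> is enclosed by the part of the component \<open>C\<close> east of the axis. The edges are those of
  the superposition of \<open>\<mu>\<close> with its mirror image \<open>nu\<close>.\<close>

definition crossings :: "'a set \<Rightarrow> int \<Rightarrow> int \<Rightarrow> int \<Rightarrow> nat" where
  "crossings C p s s' =
     card {x \<in> C. Y x = s \<and> X x > p \<and> Y (\<mu> x) = s'} + card {x \<in> C. Y x = s \<and> X x > p \<and> Y (nu x) = s'}"

text \<open>An edge between different rows is vertical, so both of its ends lie on the same side of
  \<open>p\<close>; the matching exchanges them.\<close>

lemma crossings_sym:
  assumes "C \<subseteq> R" "\<And>t. t \<in> C \<Longrightarrow> \<mu> t \<in> C" "\<And>t. t \<in> C \<Longrightarrow> nu t \<in> C" "s \<noteq> s'"
  shows "crossings C p s s' = crossings C p s' s"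
proof -
  have *: "card {x \<in> C. Y x = s \<and> X x > p \<and> Y (f x) = s'} = card {x \<in> C. Y x = s' \<and> X x > p \<and> Y (f x) = s}"
    if f: "\<And>t. t \<in> C \<Longrightarrow> f t \<in> C" "\<And>t. t \<in> C \<Longrightarrow> f (f t) = t"
      "\<And>t. t \<in> C \<Longrightarrow> \<bar>X t - X (f t)\<bar> + \<bar>Y t - Y (f t)\<bar> = 1" for f
  proof -
    have "X (f t) = X t" if "t \<in> C" "Y t \<noteq> Y (f t)" for t using f(3)[OF that(1)] that(2) by linarith
    then show ?thesis
      by (intro bij_betw_same_card[of f] bij_betw_byWitness[where f' = f]) (use f assms(4) in auto)
  qed
  show ?thesis
    unfolding crossings_def
    using *[of \<mu>] *[of nu] assms mu_step nu_step by (simp add: subset_iff)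
qed

lemma crossings_shift:
  assumes "\<And>x. x \<in> C \<Longrightarrow> \<not> (X x = p + 1 \<and> Y x = s)"
  shows "crossings C p s s' = crossings C (p + 1) s s'"
proof -
  have "X x > p \<longleftrightarrow> X x > p + 1" if "x \<in> C" "Y x = s" for x
    using assms[OF that(1)] that(2) by linarith
  then show ?thesis unfolding crossings_def
    by (intro arg_cong2[where f = "(+)"] arg_cong[where f = card]) auto
qed

text \<open>\<open>card_exits_parity\<close>, for each of the two matchings, with \<open>U\<close>
  the part of row \<open>s\<close> of \<open>C\<close> east of \<open>p\<close>: an edge that leaves
  \<open>U\<close> goes up, down, or west past \<open>p\<close>.\<close>

lemma exits_east:
  assumes "finite C" "C \<subseteq> R" "\<And>t. t \<in> C \<Longrightarrow> \<mu> t \<in> C" "\<And>t. t \<in> C \<Longrightarrow> nu t \<in> C"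
  shows "even (crossings C p s (s + 1) + crossings C p s (s - 1)
     + card {x \<in> C. Y x = s \<and> X x > p \<and> Y (\<mu> x) = s \<and> X (\<mu> x) \<le> p}
     + card {x \<in> C. Y x = s \<and> X x > p \<and> Y (nu x) = s \<and> X (nu x) \<le> p})"
proof -
  define U where "U = {x \<in> C. Y x = s \<and> X x > p}"
  have finU: "finite U" using assms(1) by (simp add: U_def)
  have *: "card {x \<in> U. f x \<notin> U} = card {x \<in> C. Y x = s \<and> X x > p \<and> Y (f x) = s + 1}
      + card {x \<in> C. Y x = s \<and> X x > p \<and> Y (f x) = s - 1}
      + card {x \<in> C. Y x = s \<and> X x > p \<and> Y (f x) = s \<and> X (f x) \<le> p}" (is "_ = card ?A + card ?B + card ?D")
    if f: "\<And>t. t \<in> C \<Longrightarrow> f t \<in> C" 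
      "\<And>t. t \<in> C \<Longrightarrow> \<bar>X t - X (f t)\<bar> + \<bar>Y t - Y (f t)\<bar> = 1" for f
  proof -
    have "Y (f x) = s + 1 \<or> Y (f x) = s - 1 \<or> Y (f x) = s" if "x \<in> C" "Y x = s" for x
      using f(2)[OF that(1)] that(2) by linarith
    then have "{x \<in> U. f x \<notin> U} = (?A \<union> ?B) \<union> ?D"
      using f(1) by (auto simp: U_def)
    moreover have "card ((?A \<union> ?B) \<union> ?D) = card (?A \<union> ?B) + card ?D"
      by (intro card_Un_disjoint) (use assms(1) in auto)
    moreover have "card (?A \<union> ?B) = card ?A + card ?B"
      by (intro card_Un_disjoint) (use assms(1) in auto)
    ultimately show ?thesis by simp
  qed
  have UR: "x \<in> R" if "x \<in> U" for x using that assms(2) by (auto simp: U_def)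
  have "even (card {x \<in> U. \<mu> x \<notin> U}) = even (card U)"
    by (rule card_exits_parity) (use finU UR mu_neq in auto)
  moreover have "even (card {x \<in> U. nu x \<notin> U}) = even (card U)"
    by (rule card_exits_parity) (use finU UR nu_neq in auto)
  ultimately have "even (card {x \<in> U. \<mu> x \<notin> U} + card {x \<in> U. nu x \<notin> U})" by simp
  moreover have "card {x \<in> U. \<mu> x \<notin> U} + card {x \<in> U. nu x \<notin> U} = crossings C p s (s + 1) + crossings C p s (s - 1)
     + card {x \<in> C. Y x = s \<and> X x > p \<and> Y (\<mu> x) = s \<and> X (\<mu> x) \<le> p}
     + card {x \<in> C. Y x = s \<and> X x > p \<and> Y (nu x) = s \<and> X (nu x) \<le> p}"
    using *[of \<mu>] *[of nu] assms mu_step nu_step by (simp add: crossings_def subset_iff)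
  ultimately show ?thesis by simp
qed

text \<open>A horizontal edge that goes west past \<open>p\<close> would end at
  \<open>(p, s)\<close>, which is not on \<open>C\<close>. Only the vertical exits remain, and their
  total is even.\<close>

lemma crossings_up_down:
  assumes "finite C" "C \<subseteq> R" "\<And>t. t \<in> C \<Longrightarrow> \<mu> t \<in> C" "\<And>t. t \<in> C \<Longrightarrow> nu t \<in> C"
    and free: "\<And>x. x \<in> C \<Longrightarrow> \<not> (X x = p \<and> Y x = s)"
  shows "even (crossings C p s (s + 1)) \<longleftrightarrow> even (crossings C p s (s - 1))"
proof -
  have *: "{x \<in> C. Y x = s \<and> X x > p \<and> Y (f x) = s \<and> X (f x) \<le> p} = {}"
    if f: "\<And>t. t \<in> C \<Longrightarrow> f t \<in> C" 
      "\<And>t. t \<in> C \<Longrightarrow> \<bar>X t - X (f t)\<bar> + \<bar>Y t - Y (f t)\<bar> = 1" for f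
  proof -
    have False if "x \<in> C" "Y x = s" "X x > p" "Y (f x) = s" "X (f x) \<le> p" for x
    proof -
      have "X (f x) = p" using f(2)[OF that(1)] that by linarith
      then show False using free[OF f(1)[OF that(1)]] that by blast
    qed
    then show ?thesis by blast
  qed
  have 1: "{x \<in> C. Y x = s \<and> X x > p \<and> Y (\<mu> x) = s \<and> X (\<mu> x) \<le> p} = {}"
    by (rule *) (use assms mu_step in auto)
  have 2: "{x \<in> C. Y x = s \<and> X x > p \<and> Y (nu x) = s \<and> X (nu x) \<le> p} = {}"
    by (rule *) (use assms nu_step in auto)
  show ?thesis
    using exits_east[OF assms(1-4), of p s] unfolding 1 2 by simp
qed

text \<open>Each point of \<open>C\<close> on the axis has exactly one of its two edges to the west.\<close>

lemma crossings_axis: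
  assumes "finite C" "C \<subseteq> R" "\<And>t. t \<in> C \<Longrightarrow> \<mu> t \<in> C" "\<And>t. t \<in> C \<Longrightarrow> nu t \<in> C"
    and nz: "\<And>t. t \<in> C \<inter> axis \<Longrightarrow> X (\<mu> t) \<noteq> 0"
  shows "even (crossings C (- 1) s (s + 1)) \<longleftrightarrow>
    even (crossings C (- 1) s (s - 1) + card {x \<in> C \<inter> axis. Y x = s})"
proof -
  let ?A = "{x \<in> C. Y x = s \<and> X x > - 1 \<and> Y (\<mu> x) = s \<and> X (\<mu> x) \<le> - 1}"
  let ?B = "{x \<in> C. Y x = s \<and> X x > - 1 \<and> Y (nu x) = s \<and> X (nu x) \<le> - 1}"
  have west: "X x = 0 \<and> X (nu x) = - X (\<mu> x)"
    if "x \<in> C" "Y x = s" "X x > - 1" "(Y (\<mu> x) = s \<and> X (\<mu> x) \<le> - 1) \<or> (Y (nu x) = s \<and> X (nu x) \<le> - 1)" for x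
  proof -
    have xR: "x \<in> R" using that assms by blast
    then have X0: "X x = 0" using mu_step[OF xR] nu_step[OF xR] that by linarith
    then have "nu x = \<sigma> (\<mu> x)" using xR by (intro nu_axis) (simp add: axis_def)
    then show ?thesis using xR X0 that(4) by auto
  qed
  have ax: "Y (\<mu> x) = s \<and> Y (nu x) = s \<and> X (nu x) = - X (\<mu> x) \<and> X (\<mu> x) \<noteq> 0"
    if "x \<in> C \<inter> axis" "Y x = s" for x
  proof -
    have x: "x \<in> R" "X x = 0" using that by (auto simp: axis_def)
    have "nu x = \<sigma> (\<mu> x)" using that by (intro nu_axis) auto
    moreover have "Y (\<mu> x) = s" using mu_step[OF x(1)] nz[OF that(1)] x(2) that(2) by linarith
    ultimately show ?thesis using x nz[OF that(1)] by simp
  qed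
  have "{x \<in> C \<inter> axis. Y x = s} = ?A \<union> ?B"
  proof (intro set_eqI iffI)
    fix x assume x: "x \<in> {x \<in> C \<inter> axis. Y x = s}"
    then have "X (\<mu> x) \<le> - 1 \<or> X (nu x) \<le> - 1" using ax[of x] by auto
    then show "x \<in> ?A \<union> ?B" using ax[of x] x by (auto simp: axis_def)
  next
    fix x assume x: "x \<in> ?A \<union> ?B"
    then show "x \<in> {x \<in> C \<inter> axis. Y x = s}"
      using west[of x] assms(2) by (auto simp: axis_def)
  qed
  moreover have "?A \<inter> ?B = {}"
  proof -
    have False if "x \<in> ?A" "x \<in> ?B" for x using west[of x] that by auto
    then show ?thesis by blast
  qed
  moreover have fin: "finite ?A" "finite ?B" using assms(1) by auto
  ultimately have "card {x \<in> C \<inter> axis. Y x = s} = card ?A + card ?B"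
    using card_Un_disjoint[OF fin] by (simp only:)
  then show ?thesis
    using exits_east[OF assms(1-4), of "- 1" s] by (simp only: even_add) blast
qed

text \<open>The value -1 lets the ray include the axis itself. Nothing is crossed below
  \<open>C\<close>, and by \<open>crossings_axis\<close> the parity changes from row to row with the
  axis points met.\<close>

lemma crossings_axis_count:
  assumes "finite C" "C \<subseteq> R" "\<And>t. t \<in> C \<Longrightarrow> \<mu> t \<in> C" "\<And>t. t \<in> C \<Longrightarrow> nu t \<in> C"
    and nz: "\<And>t. t \<in> C \<inter> axis \<Longrightarrow> X (\<mu> t) \<noteq> 0"
  shows "even (crossings C (- 1) s (s + 1)) \<longleftrightarrow> even (card {x \<in> C \<inter> axis. Y x \<le> s})"
proof -
  obtain s0 where s0: "\<And>x. x \<in> C \<Longrightarrow> s0 < Y x"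
  proof
    fix x assume "x \<in> C"
    then have "Min (Y ` C) \<le> Y x" using assms(1) by (intro Min_le) auto
    then show "Min (Y ` C) - 1 < Y x" by linarith
  qed
  have base: "even (crossings C (- 1) s (s + 1)) \<longleftrightarrow> even (card {x \<in> C \<inter> axis. Y x \<le> s})" if "s \<le> s0" for s
  proof -
    have "crossings C (- 1) s (s + 1) = 0" "{x \<in> C \<inter> axis. Y x \<le> s} = {}"
      using s0 that assms(1) by (fastforce simp: crossings_def)+
    then show ?thesis by (simp only: card.empty)
  qed
  show ?thesis
  proof (cases "s0 \<le> s")
    case True
    then show ?thesis
    proof (induction s rule: int_ge_induct)
      case (step s)
      have "card {x \<in> C \<inter> axis. Y x \<le> s + 1} = card ({x \<in> C \<inter> axis. Y x \<le> s} \<union> {x \<in> C \<inter> axis. Y x = s + 1})"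
        by (rule arg_cong[where f = card]) auto
      also have "\<dots> = card {x \<in> C \<inter> axis. Y x \<le> s} + card {x \<in> C \<inter> axis. Y x = s + 1}"
        by (rule card_Un_disjoint) (use assms(1) in auto)
      finally have c: "card {x \<in> C \<inter> axis. Y x \<le> s + 1} = card {x \<in> C \<inter> axis. Y x \<le> s} + card {x \<in> C \<inter> axis. Y x = s + 1}" .
      have "crossings C (- 1) (s + 1) s = crossings C (- 1) s (s + 1)"
        by (rule crossings_sym) (use assms in auto)
      then show ?case
        using crossings_axis[OF assms, of "s + 1"] step.IH c by simp
    qed (use base in simp)
  qed (use base in simp)
qed

text \<open>Off \<open>C\<close> the parity is locally constant: a vertical step is handled by
  \<open>crossings_up_down\<close>, and a horizontal one shortens or lengthens the ray by a point
  that is not on \<open>C\<close>.\<close>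

lemma crossings_step:
  assumes C: "finite C" "C \<subseteq> R" "\<And>t. t \<in> C \<Longrightarrow> \<mu> t \<in> C" "\<And>t. t \<in> C \<Longrightarrow> nu t \<in> C"
    and t: "t \<in> R" "t' \<in> R" "t \<notin> C" "t' \<notin> C" "\<bar>X t - X t'\<bar> + \<bar>Y t - Y t'\<bar> = 1"
  shows "even (crossings C (X t) (Y t) (Y t + 1)) \<longleftrightarrow> even (crossings C (X t') (Y t') (Y t' + 1))"
proof -
  have free: "\<And>x. x \<in> C \<Longrightarrow> \<not> (X x = X t \<and> Y x = Y t)" "\<And>x. x \<in> C \<Longrightarrow> \<not> (X x = X t' \<and> Y x = Y t')"
    using t coord_inj C(2) by blast+
  have vert: "even (crossings C p s (s + 1)) \<longleftrightarrow> even (crossings C p (s + 1) (s + 1 + 1))"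
    if "\<And>x. x \<in> C \<Longrightarrow> \<not> (X x = p \<and> Y x = s + 1)" for p s
    using crossings_up_down[OF C, of p "s + 1"] that crossings_sym[OF C(2-4), of s "s + 1" p] by simp
  consider "X t' = X t" "Y t' = Y t + 1" | "X t = X t'" "Y t = Y t' + 1"
    | "Y t' = Y t" "X t' = X t + 1" | "Y t = Y t'" "X t = X t' + 1"
    using t(5) by linarith
  then show ?thesis
  proof cases
    case 1
    then show ?thesis using vert[of "X t" "Y t"] free(2) by (simp only:) metis
  next
    case 2
    then show ?thesis using vert[of "X t'" "Y t'"] free(1) by (simp only:) metis
  next
    case 3
    then have "crossings C (X t) (Y t) (Y t + 1) = crossings C (X t + 1) (Y t) (Y t + 1)"
      using free(2) by (intro crossings_shift) metis
    then show ?thesis using 3 by (simp only:)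
  next
    case 4
    then have "crossings C (X t') (Y t') (Y t' + 1) = crossings C (X t' + 1) (Y t') (Y t' + 1)"
      using free(1) by (intro crossings_shift) metis
    then show ?thesis using 4 by (simp only:)
  qed
qed

text \<open>The component meets the axis only in \<open>v\<close> and \<open>w\<close>, so the count
  in \<open>crossings_axis_count\<close> is odd, namely 1, only between them.\<close>

lemma axis_between_parity:
  assumes v: "v \<in> axis" "X (\<mu> v) \<noteq> 0" and w: "comp v \<inter> axis = {v, w}" "X (\<mu> w) \<noteq> 0" "Y v < Y w"
    and t: "t \<in> axis" "t \<notin> comp v"
  shows "odd (crossings (comp v) (X t) (Y t) (Y t + 1)) \<longleftrightarrow> Y v < Y t \<and> Y t < Y w"
proof -
  let ?C = "comp v"
  have vR: "v \<in> R" and tR: "t \<in> R" "X t = 0" using v t by (auto simp: axis_def)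
  have C: "finite ?C" "?C \<subseteq> R" "\<And>t. t \<in> ?C \<Longrightarrow> \<mu> t \<in> ?C" "\<And>t. t \<in> ?C \<Longrightarrow> nu t \<in> ?C"
    using comp_subset[OF vR] finite_comp[OF vR] by (auto intro: comp.intros)
  have free: "\<And>x. x \<in> ?C \<Longrightarrow> \<not> (X x = X t \<and> Y x = Y t)"
    using tR t coord_inj C(2) by blast
  then have "crossings ?C (X t) (Y t) (Y t + 1) = crossings ?C (- 1) (Y t) (Y t + 1)"
    using crossings_shift[of ?C "- 1" "Y t" "Y t + 1"] tR by simp
  moreover have "even (crossings ?C (- 1) (Y t) (Y t + 1)) \<longleftrightarrow> even (card {x \<in> ?C \<inter> axis. Y x \<le> Y t})"
    by (rule crossings_axis_count[OF C]) (use v w in auto)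
  moreover have ne: "Y v \<noteq> Y t" "Y w \<noteq> Y t"
    using free[of v] free[of w] w(1) tR v by (auto simp: axis_def intro: comp.intros)
  moreover have "{x \<in> ?C \<inter> axis. Y x \<le> Y t} =
      (if Y t < Y v then {} else if Y t < Y w then {v} else {v, w})"
    unfolding w(1) using w(3) ne by auto
  moreover have "v \<noteq> w" using w by auto
  ultimately show ?thesis using w(3) by auto
qed

text \<open>Different components do not cross: a walk that starts off \<open>C\<close> stays off
  \<open>C\<close>, and each of its steps preserves the parity.\<close>

lemma crossings_path:
  assumes C: "finite C" "C \<subseteq> R" "\<And>t. t \<in> C \<Longrightarrow> \<mu> t \<in> C" "\<And>t. t \<in> C \<Longrightarrow> nu t \<in> C"
    and t: "t \<in> R" "t \<notin> C"
  shows "path b t i \<notin> C \<and> (even (crossings C (X t) (Y t) (Y t + 1)) \<longleftrightarrow>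
    even (crossings C (X (path b t i)) (Y (path b t i)) (Y (path b t i) + 1)))"
proof (induction i)
  case (Suc i)
  have R: "path b t i \<in> R" "path b t (Suc i) \<in> R" using path_in_R[OF t(1)] by blast+
  have "path b t (Suc i) \<notin> C"
    using Suc path_pred[OF t(1), of b i] C(3,4) by metis
  then show ?case
    using crossings_step[OF C R _ _ path_step[OF t(1)]] Suc by blast
qed (use t in simp)

text \<open>The map \<open>f\<close> takes an axis point to the other axis point of its component.
  Points between \<open>v\<close> and \<open>w\<close> are enclosed, and so are their images; hence
  \<open>f\<close> is an involution without fixed points on them.\<close>

lemma even_between:
  assumes v: "v \<in> axis" "X (\<mu> v) \<noteq> 0" and w: "comp v \<inter> axis = {v, w}" "X (\<mu> w) \<noteq> 0" "Y v < Y w"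
  shows "even (card {t \<in> axis. Y v < Y t \<and> Y t < Y w})" (is "even (card ?B)")
proof -
  define f where "f t = (THE u. comp t \<inter> axis = {t, u} \<and> u \<noteq> t)" for t
  have f: "comp t \<inter> axis = {t, f t} \<and> f t \<noteq> t" if t: "t \<in> axis" for t
  proof -
    obtain u where u: "comp t \<inter> axis = {t, u}" "u \<noteq> t" using comp_axis[OF t] by metis
    show ?thesis unfolding f_def by (rule theI[of _ u]) (use u in auto)
  qed
  have vR: "v \<in> R" and wR: "w \<in> axis" using v w(1) by (auto simp: axis_def)
  have C: "finite (comp v)" "comp v \<subseteq> R" "\<And>t. t \<in> comp v \<Longrightarrow> \<mu> t \<in> comp v" "\<And>t. t \<in> comp v \<Longrightarrow> nu t \<in> comp v"
    using comp_subset[OF vR] finite_comp[OF vR] by (auto intro: comp.intros)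
  show ?thesis
  proof (rule even_card_involution[where f = f])
    show "finite ?B" using finite_R by (simp add: axis_def)
    fix t assume "t \<in> ?B"
    then have t: "t \<in> axis" "Y v < Y t" "Y t < Y w" by auto
    then have tR: "t \<in> R" by (simp add: axis_def)
    show "f t \<noteq> t" using f t by blast
    have ft: "f t \<in> axis" "f t \<in> comp t" using f[OF t(1)] by blast+
    show "f (f t) = t"
    proof -
      have "t \<in> comp (f t)" using ft tR comp_sym by blast
      then have "t \<in> {f t, f (f t)}" using f[OF ft(1)] t(1) by (metis IntI)
      then show ?thesis using \<open>f t \<noteq> t\<close> by auto
    qed
    have nt: "t \<notin> comp v" using t w(1) by auto
    then have nft: "f t \<notin> comp v"
      using ft comp_sym[OF tR ft(2)] comp_trans by blast
    obtain u n b where u: "u \<noteq> t" "comp t \<inter> axis = {t, u}" "path b t n = u"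
      using comp_axis[OF t(1)] by metis
    then have "path b t n = f t" using f[OF t(1)] by (metis doubleton_eq_iff)
    then have "even (crossings (comp v) (X t) (Y t) (Y t + 1)) \<longleftrightarrow>
       even (crossings (comp v) (X (f t)) (Y (f t)) (Y (f t) + 1))"
      using crossings_path[OF C tR nt, of b n] by simp
    then show "f t \<in> ?B"
      using axis_between_parity[OF v w t(1) nt] axis_between_parity[OF v w ft(1) nft] t ft by simp
  qed
qed

section \<open>Parity of ranks on the axis\<close>

lemma rank_parity_less:
  assumes "v \<in> axis" "w \<in> axis" "Y v < Y w" "even (card {t \<in> axis. Y v < Y t \<and> Y t < Y w})"
  shows "odd (rank v + rank w)"
proof -
  have fin: "finite axis" using finite_R by (simp add: axis_def)
  have "{u \<in> axis. Y u < Y w} = insert v ({u \<in> axis. Y u < Y v} \<union> {t \<in> axis. Y v < Y t \<and> Y t < Y w})"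
    using assms coord_inj[of _ v] by (force simp: axis_def)
  moreover have "card (insert v ({u \<in> axis. Y u < Y v} \<union> {t \<in> axis. Y v < Y t \<and> Y t < Y w}))
     = Suc (card {u \<in> axis. Y u < Y v} + card {t \<in> axis. Y v < Y t \<and> Y t < Y w})"
    using fin by (subst card_insert_disjoint) (auto intro!: card_Un_disjoint)
  ultimately show ?thesis using assms(4) by (simp add: rank_def)
qed

lemma rank_parity:
  assumes v: "v \<in> axis" and w: "comp v \<inter> axis = {v, w}" "v \<noteq> w"
  shows "odd (rank v + rank w)"
proof -
  have vR: "v \<in> R" and wA: "w \<in> axis" and wR: "w \<in> R" using v w(1) by (auto simp: axis_def)
  have ne: "Y v \<noteq> Y w" using coord_inj[OF vR wR] v wA w(2) by (auto simp: axis_def)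
  show ?thesis
  proof (cases "X (\<mu> v) = 0")
    case True
    then have "\<mu> v \<in> axis" using vR by (simp add: axis_def)
    then have "\<mu> v = w" using w(1) mu_neq[OF vR] comp.mu[OF comp.base, of v] by blast
    then have "\<bar>Y v - Y w\<bar> = 1" using mu_step[OF vR] True v by (simp add: axis_def)
    then have "{t \<in> axis. Y v < Y t \<and> Y t < Y w} = {}" "{t \<in> axis. Y w < Y t \<and> Y t < Y v} = {}" by auto
    then show ?thesis
      using rank_parity_less[OF v wA] rank_parity_less[OF wA v] ne
      by (metis add.commute card.empty even_zero linorder_neqE_linordered_idom)
  next
    case False
    obtain u where "comp v \<inter> axis = {v, u}" "u \<noteq> v" "X (\<mu> u) \<noteq> 0"
      using comp_axis[OF v] False by metis
    then have w0: "X (\<mu> w) \<noteq> 0" using w by auto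
    have cw: "comp w = comp v"
      using w(1) comp_sym[OF vR, of w] comp_trans by blast
    consider "Y v < Y w" | "Y w < Y v" using ne by linarith
    then show ?thesis
    proof cases
      case 1
      show ?thesis by (rule rank_parity_less[OF v wA 1 even_between[OF v False w(1) w0 1]])
    next
      case 2
      have "odd (rank w + rank v)"
        by (rule rank_parity_less[OF wA v 2 even_between[OF wA w0 _ False 2]])
          (use w(1) cw in auto)
      then show ?thesis by (simp add: add.commute)
    qed
  qed
qed

end

section \<open>Tilings as perfect matchings\<close>

text \<open>The doubled horizontal position of the centre. Together with \<open>strip\<close>, the
  level of the lower boundary of the strip that contains the triangle, it turns lozenges into unit
  steps of the grid.\<close>

fun cx :: "triangle \<Rightarrow> int" where
  "cx (Up p k) = p + 1"
| "cx (Down p k) = p + 1"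

fun strip :: "triangle \<Rightarrow> int" where
  "strip (Up p k) = k"
| "strip (Down p k) = k - 1"

section \<open>Lozenges as pairs of grid neighbours\<close>

lemma lozenge_pair_iff: "is_lozenge {s, t} \<longleftrightarrow> s \<noteq> t \<and> card (vertices s \<inter> vertices t) = 2"
  by (auto simp: is_lozenge_def doubleton_eq_iff Int_commute)

lemma not_lozenge_Up_Up: "\<not> is_lozenge {Up p k, Up q j}"
proof
  assume "is_lozenge {Up p k, Up q j}"
  then obtain u v where uv: "u \<noteq> v" "vertices (Up p k) \<inter> vertices (Up q j) = {u, v}" "p \<noteq> q \<or> k \<noteq> j"
    by (auto simp: lozenge_pair_iff card_2_iff)
  then have "u \<in> vertices (Up p k)" "v \<in> vertices (Up p k)" "u \<in> vertices (Up q j)" "v \<in> vertices (Up q j)"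
    by blast+
  then show False
    using uv(1,3) by auto
qed

lemma not_lozenge_Down_Down: "\<not> is_lozenge {Down p k, Down q j}"
proof
  assume "is_lozenge {Down p k, Down q j}"
  then obtain u v where uv: "u \<noteq> v" "vertices (Down p k) \<inter> vertices (Down q j) = {u, v}" "p \<noteq> q \<or> k \<noteq> j"
    by (auto simp: lozenge_pair_iff card_2_iff)
  then have "u \<in> vertices (Down p k)" "v \<in> vertices (Down p k)" "u \<in> vertices (Down q j)" "v \<in> vertices (Down q j)"
    by blast+
  then show False
    using uv(1,3) by auto
qed

lemma lozenge_Up_Down_iff:
  "is_lozenge {Up p k, Down q j} \<longleftrightarrow> (q = p \<and> j = k) \<or> (j = k + 1 \<and> (q = p + 1 \<or> q = p - 1))"
proof
  assume "is_lozenge {Up p k, Down q j}"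
  then obtain u v where uv: "u \<noteq> v" "vertices (Up p k) \<inter> vertices (Down q j) = {u, v}"
    by (auto simp: lozenge_pair_iff card_2_iff)
  then have "u \<in> vertices (Up p k)" "v \<in> vertices (Up p k)" "u \<in> vertices (Down q j)" "v \<in> vertices (Down q j)"
    by blast+
  then show "(q = p \<and> j = k) \<or> (j = k + 1 \<and> (q = p + 1 \<or> q = p - 1))"
    using uv(1) by auto
next
  assume "(q = p \<and> j = k) \<or> (j = k + 1 \<and> (q = p + 1 \<or> q = p - 1))"
  then consider "q = p" "j = k" | "q = p + 1" "j = k + 1" | "q = p - 1" "j = k + 1" by blast
  then have "\<exists>u v. u \<noteq> v \<and> vertices (Up p k) \<inter> vertices (Down q j) = {u, v}"
  proof cases
    case 1
    then show ?thesis by (intro exI[of _ "(p, k)"] exI[of _ "(p + 2, k)"]) auto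
  next
    case 2
    then show ?thesis by (intro exI[of _ "(p + 1, k + 1)"] exI[of _ "(p + 2, k)"]) auto
  next
    case 3
    then show ?thesis by (intro exI[of _ "(p + 1, k + 1)"] exI[of _ "(p, k)"]) auto
  qed
  then show "is_lozenge {Up p k, Down q j}"
    by (simp add: lozenge_pair_iff card_2_iff) blast
qed

lemma lozenge_Down_Up_iff:
  "is_lozenge {Down q j, Up p k} \<longleftrightarrow> (q = p \<and> j = k) \<or> (j = k + 1 \<and> (q = p + 1 \<or> q = p - 1))"
  using lozenge_Up_Down_iff by (simp add: insert_commute)

lemmas lozenge_iffs = not_lozenge_Up_Up not_lozenge_Down_Down lozenge_Up_Down_iff lozenge_Down_Up_iff

lemma lozenge_step: "is_lozenge {s, t} \<Longrightarrow> \<bar>cx s - cx t\<bar> + \<bar>strip s - strip t\<bar> = 1"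
  by (cases s; cases t) (auto simp: lozenge_iffs)

lemma lozenge_obtain:
  assumes "is_lozenge l" obtains s t where "l = {s, t}" "s \<noteq> t"
  using assms by (auto simp: is_lozenge_def)

lemma mirror_mirror [simp]: "mirror (mirror t) = t"
  by (cases t) auto

lemma inj_mirror: "inj mirror"
  by (metis injI mirror_mirror)

lemma cx_mirror [simp]: "cx (mirror t) = - cx t"
  by (cases t) auto

lemma strip_mirror [simp]: "strip (mirror t) = strip t"
  by (cases t) auto

lemma lozenge_mirror: "is_lozenge {mirror s, mirror t} \<longleftrightarrow> is_lozenge {s, t}"
  by (cases s; cases t) (auto simp: lozenge_iffs)

text \<open>\<open>Up p k\<close> and \<open>Down p (k + 1)\<close> have the same coordinates, but
  only one of them has its vertices in the lattice.\<close>

lemma lattice_coord_inj: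
  assumes "s \<in> faces_in (lattice c)" "t \<in> faces_in (lattice c)" "cx s = cx t" "strip s = strip t"
  shows "s = t"
  using assms by (cases s; cases t) (auto simp: faces_in_def lattice_def)

text \<open>Fixing all triangles outside \<open>R\<close> makes a matching unique as a function, so
  that \<open>tiles R\<close> becomes a bijection onto the tilings.\<close>

definition matchings :: "triangle set \<Rightarrow> (triangle \<Rightarrow> triangle) set" where
  "matchings R = {\<mu>. (\<forall>t. t \<notin> R \<longrightarrow> \<mu> t = t) \<and> (\<forall>t\<in>R. \<mu> t \<in> R \<and> \<mu> (\<mu> t) = t \<and> is_lozenge {t, \<mu> t})}"

definition tiles :: "triangle set \<Rightarrow> (triangle \<Rightarrow> triangle) \<Rightarrow> triangle set set" where
  "tiles R \<mu> = (\<lambda>t. {t, \<mu> t}) ` R"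

lemma matchingsD:
  assumes "\<mu> \<in> matchings R"
  shows "t \<notin> R \<Longrightarrow> \<mu> t = t" "t \<in> R \<Longrightarrow> \<mu> t \<in> R" "t \<in> R \<Longrightarrow> \<mu> (\<mu> t) = t"
    "t \<in> R \<Longrightarrow> is_lozenge {t, \<mu> t}" "t \<in> R \<Longrightarrow> \<mu> t \<noteq> t"
  using assms by (auto simp: matchings_def lozenge_pair_iff)

lemma tiles_in_tilings:
  assumes "\<mu> \<in> matchings R" shows "tiles R \<mu> \<in> tilings R"
proof -
  note D = matchingsD[OF assms]
  have "{s, \<mu> s} = {t, \<mu> t}" if "s \<in> R" "t \<in> R" "{s, \<mu> s} \<inter> {t, \<mu> t} \<noteq> {}" for s t
  proof -
    have "s = t \<or> s = \<mu> t \<or> \<mu> s = t \<or> \<mu> s = \<mu> t" using that(3) by auto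
    then have "s = t \<or> s = \<mu> t" using D(3) that by metis
    then show ?thesis using D(3)[OF that(2)] by auto
  qed
  then have "disjoint (tiles R \<mu>)"
    unfolding tiles_def disjoint_def by blast
  then show ?thesis
    using D by (auto simp: tilings_def partition_on_def tiles_def)
qed

lemma tiles_block:
  assumes "\<mu> \<in> matchings R" "l \<in> tiles R \<mu>" "t \<in> l" shows "t \<in> R" "l = {t, \<mu> t}"
  using assms(2,3) matchingsD[OF assms(1)] unfolding tiles_def by auto

lemma bij_betw_tiles: "bij_betw (tiles R) (matchings R) (tilings R)"
  unfolding bij_betw_def
proof
  show "inj_on (tiles R) (matchings R)"
  proof (intro inj_onI ext)
    fix \<mu> \<mu>' t assume *: "\<mu> \<in> matchings R" "\<mu>' \<in> matchings R" "tiles R \<mu> = tiles R \<mu>'"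
    show "\<mu> t = \<mu>' t"
    proof (cases "t \<in> R")
      case True
      then have "{t, \<mu> t} \<in> tiles R \<mu>'" using *(3) by (auto simp: tiles_def)
      then have "{t, \<mu> t} = {t, \<mu>' t}" using tiles_block(2)[OF *(2)] by blast
      then show ?thesis by (metis doubleton_eq_iff)
    qed (use matchingsD(1) * in metis)
  qed
  show "tiles R ` matchings R = tilings R"
  proof (intro equalityI subsetI)
    fix T assume "T \<in> tilings R"
    then have P: "partition_on R T" and L: "\<And>l. l \<in> T \<Longrightarrow> is_lozenge l" by (auto simp: tilings_def)
    have uniq: "l = l'" if "l \<in> T" "l' \<in> T" "t \<in> l" "t \<in> l'" for l l' t
      using that P by (auto simp: partition_on_def disjoint_def)
    define \<mu> where "\<mu> t = (if t \<in> R then THE s. {t, s} \<in> T else t)" for t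
    have \<mu>: "\<mu> t = s" if st: "{t, s} \<in> T" for s t
    proof -
      have "t \<in> R" using P st by (auto simp: partition_on_def)
      moreover have "(THE s. {t, s} \<in> T) = s"
      proof (rule the_equality[where P = "\<lambda>s. {t, s} \<in> T", OF st])
        fix s' assume "{t, s'} \<in> T"
        then have "{t, s'} = {t, s}" by (rule uniq[OF _ st, of _ t]) auto
        then show "s' = s" by (auto simp: doubleton_eq_iff)
      qed
      ultimately show ?thesis by (simp add: \<mu>_def)
    qed
    have ex: "\<exists>s. {t, s} \<in> T" if tR: "t \<in> R" for t
    proof -
      obtain l where "l \<in> T" "t \<in> l" using P tR by (auto simp: partition_on_def)
      moreover obtain u v where "l = {u, v}" using L[OF \<open>l \<in> T\<close>] by (auto simp: is_lozenge_def)
      ultimately show ?thesis by (metis insertE insert_commute singletonD)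
    qed
    have blk: "{t, \<mu> t} \<in> T" if "t \<in> R" for t using ex[OF that] \<mu> by auto
    have "\<mu> \<in> matchings R"
      unfolding matchings_def
    proof (intro CollectI conjI allI impI ballI)
      fix t assume t: "t \<in> R"
      show "\<mu> t \<in> R" using blk[OF t] P by (auto simp: partition_on_def)
      show "\<mu> (\<mu> t) = t" using blk[OF t] by (intro \<mu>) (simp add: insert_commute)
      show "is_lozenge {t, \<mu> t}" using blk[OF t] by (rule L)
    qed (simp add: \<mu>_def)
    moreover have "T = tiles R \<mu>"
    proof (intro equalityI subsetI)
      fix l assume l: "l \<in> T"
      then obtain u v where uv: "l = {u, v}" using L lozenge_obtain by metis
      then have "u \<in> R" using P l by (auto simp: partition_on_def)
      then show "l \<in> tiles R \<mu>" using uv l \<mu> by (auto simp: tiles_def)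
    qed (use blk in \<open>auto simp: tiles_def\<close>)
    ultimately show "T \<in> tiles R ` matchings R" by blast
  qed (auto intro: tiles_in_tilings)
qed

lemma M_matchings: "M (R, w) = (\<Sum>\<mu>\<in>matchings R. \<Prod>l\<in>tiles R \<mu>. w l)"
  unfolding M_def prod.case by (rule sum.reindex_bij_betw[OF bij_betw_tiles, symmetric])

lemma finite_matchings: "finite R \<Longrightarrow> finite (matchings R)"
  using bij_betw_finite[OF bij_betw_tiles] finite_tilings by blast

section \<open>Weighted counts under maps and decompositions\<close>

lemma M_cong:
  assumes "\<And>l. l \<subseteq> R \<Longrightarrow> is_lozenge l \<Longrightarrow> w l = w' l" shows "M (R, w) = M (R, w')"
  unfolding M_def using assms
  by (auto simp: tilings_def partition_on_def intro!: sum.cong prod.cong)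

text \<open>An injection that preserves and reflects lozenges induces a bijection of tilings. It is
  applied to the reflection and to translations.\<close>

lemma M_image:
  assumes f: "inj f" and loz: "\<And>s t. is_lozenge {f s, f t} \<longleftrightarrow> is_lozenge {s, t}"
  shows "M (f ` R, w) = M (R, \<lambda>l. w (f ` l))"
proof -
  have inv: "f ` (inv f ` S) = S" if "S \<subseteq> f ` R" for S
  proof -
    have "f (inv f x) = x" if "x \<in> S" for x
      using \<open>S \<subseteq> f ` R\<close> that by (intro f_inv_into_f) blast
    then show ?thesis by (simp add: image_image)
  qed
  have loz': "is_lozenge (f ` l) \<longleftrightarrow> is_lozenge l" for l
  proof
    assume "is_lozenge (f ` l)"
    then obtain u v where uv: "f ` l = {u, v}" "is_lozenge {u, v}" by (metis lozenge_obtain)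
    then obtain s t where "s \<in> l" "t \<in> l" "u = f s" "v = f t" by blast
    moreover then have "l = {s, t}" using uv(1) f by (metis image_empty image_insert inj_image_eq_iff)
    ultimately show "is_lozenge l" using uv loz by simp
  next
    assume l: "is_lozenge l"
    then obtain u v where "l = {u, v}" by (metis lozenge_obtain)
    then show "is_lozenge (f ` l)" using l loz by simp
  qed
  have til: "(`) f ` T \<in> tilings (f ` R) \<longleftrightarrow> T \<in> tilings R" for T
  proof -
    have "\<Union> ((`) f ` T) = f ` \<Union> T" by auto
    then have "\<Union> ((`) f ` T) = f ` R \<longleftrightarrow> \<Union> T = R" using f by (simp add: inj_image_eq_iff)
    moreover have "disjoint ((`) f ` T) \<longleftrightarrow> disjoint T"
      using f by (auto simp: disjoint_def inj_image_eq_iff image_Int[symmetric])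
    ultimately show ?thesis
      using loz' by (auto simp: tilings_def partition_on_def)
  qed
  have injT: "inj ((`) ((`) f))" using f by (simp add: inj_on_image)
  have "tilings (f ` R) = (`) ((`) f) ` tilings R"
  proof (intro equalityI subsetI)
    fix T assume T: "T \<in> tilings (f ` R)"
    have "f ` inv f ` l = l" if "l \<in> T" for l
      using T that by (intro inv) (auto simp: tilings_def partition_on_def)
    then have "(`) f ` ((`) (inv f) ` T) = T" by (force simp: image_image)
    then show "T \<in> (`) ((`) f) ` tilings R" using T til by (metis imageI)
  qed (use til in auto)
  then have "M (f ` R, w) = (\<Sum>T\<in>tilings R. \<Prod>l\<in>(`) f ` T. w l)"
    unfolding M_def using injT by (simp add: sum.reindex inj_on_subset)
  also have "\<dots> = M (R, \<lambda>l. w (f ` l))"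
    unfolding M_def prod.case
    by (intro sum.cong refl) (use f in \<open>subst prod.reindex; auto simp: inj_on_def inj_image_eq_iff\<close>)
  finally show ?thesis .
qed

lemma Union_parts:
  assumes "\<Union> T = A \<union> B" "A \<inter> B = {}" "\<forall>l\<in>T. l \<subseteq> A \<or> l \<subseteq> B"
  shows "\<Union> {l \<in> T. l \<subseteq> A} = A"
proof (intro equalityI subsetI)
  fix t assume t: "t \<in> A"
  then obtain l where l: "l \<in> T" "t \<in> l" using assms(1) by blast
  then have "l \<subseteq> A" using assms(2,3) t by blast
  then show "t \<in> \<Union> {l \<in> T. l \<subseteq> A}" using l by blast
qed blast

text \<open>A tiling in which no lozenge straddles \<open>A\<close> and \<open>B\<close> is a tiling
  of \<open>A\<close> together with one of \<open>B\<close>. This serves both the cut along the axis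
  and the removal of forced lozenges.\<close>

lemma M_Un:
  assumes "finite A" "finite B" "A \<inter> B = {}"
  shows "M (A, w) * M (B, w) = (\<Sum>T | T \<in> tilings (A \<union> B) \<and> (\<forall>l\<in>T. l \<subseteq> A \<or> l \<subseteq> B). \<Prod>l\<in>T. w l)"
proof -
  let ?S = "{T. T \<in> tilings (A \<union> B) \<and> (\<forall>l\<in>T. l \<subseteq> A \<or> l \<subseteq> B)}"
  have sep: "U \<inter> V = {}" if "U \<in> tilings A" "V \<in> tilings B" for U V
  proof -
    have "\<Union> U = A" "\<Union> V = B" "{} \<notin> U"
      using that by (auto simp: tilings_def partition_on_def)
    then have "l = {}" if "l \<in> U" "l \<in> V" for l
      using assms(3) that by (metis Sup_upper bot.extremum_uniqueI le_inf_iff)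
    then show ?thesis using \<open>{} \<notin> U\<close> by auto
  qed
  have fin: "finite U" "finite V" if "U \<in> tilings A" "V \<in> tilings B" for U V
    using that finite_elements[OF assms(1), of U] finite_elements[OF assms(2), of V]
    by (simp_all add: tilings_def)
  have "M (A, w) * M (B, w) = (\<Sum>(U, V)\<in>tilings A \<times> tilings B. \<Prod>l\<in>U \<union> V. w l)"
    unfolding M_def sum_product sum.cartesian_product prod.case
    by (rule sum.cong) (auto simp: prod.union_disjoint sep fin)
  also have "\<dots> = (\<Sum>T\<in>?S. \<Prod>l\<in>T. w l)"
  proof (rule sum.reindex_bij_witness[where j = "\<lambda>(U, V). U \<union> V" and i = "\<lambda>T. ({l \<in> T. l \<subseteq> A}, {l \<in> T. l \<subseteq> B})"])
    fix T assume T: "T \<in> ?S"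
    then show "(\<lambda>(U, V). U \<union> V) ({l \<in> T. l \<subseteq> A}, {l \<in> T. l \<subseteq> B}) = T" by auto
    have "\<Union> {l \<in> T. l \<subseteq> A} = A" "\<Union> {l \<in> T. l \<subseteq> B} = B"
    proof -
      have "\<Union> T = A \<union> B" using T by (auto simp: tilings_def partition_on_def)
      moreover have "\<forall>l\<in>T. l \<subseteq> A \<or> l \<subseteq> B" "\<forall>l\<in>T. l \<subseteq> B \<or> l \<subseteq> A" using T by blast+
      ultimately show "\<Union> {l \<in> T. l \<subseteq> A} = A" "\<Union> {l \<in> T. l \<subseteq> B} = B"
        using Union_parts[of T A B] Union_parts[of T B A] assms(3) by (simp_all add: Un_commute Int_commute)
    qed
    then show "({l \<in> T. l \<subseteq> A}, {l \<in> T. l \<subseteq> B}) \<in> tilings A \<times> tilings B"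
      using T by (auto simp: tilings_def partition_on_def disjoint_def)
  next
    fix UV assume "UV \<in> tilings A \<times> tilings B"
    then obtain U V where UV: "UV = (U, V)" "U \<in> tilings A" "V \<in> tilings B" by blast
    then have un: "\<Union> U = A" "\<Union> V = B" "{} \<notin> U" "{} \<notin> V" by (auto simp: tilings_def partition_on_def)
    have sub: "l \<subseteq> A" "l \<noteq> {}" if "l \<in> U" for l using that un(1,3) by blast+
    have sub': "l \<subseteq> B" "l \<noteq> {}" if "l \<in> V" for l using that un(2,4) by blast+
    have "\<not> l \<subseteq> B" if "l \<in> U" for l using sub[OF that] assms(3) by blast
    moreover have "\<not> l \<subseteq> A" if "l \<in> V" for l using sub'[OF that] assms(3) by blast
    ultimately have "{l \<in> U \<union> V. l \<subseteq> A} = U" "{l \<in> U \<union> V. l \<subseteq> B} = V"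
      using sub(1) sub'(1) by blast+
    then show "(\<lambda>T. ({l \<in> T. l \<subseteq> A}, {l \<in> T. l \<subseteq> B})) ((\<lambda>(U, V). U \<union> V) UV) = UV"
      by (simp add: UV(1))
    have "disjoint (U \<union> V)"
      using UV(2,3) un(1,2) assms(3) by (intro disjoint_union) (auto simp: tilings_def partition_on_def)
    moreover have "\<Union> (U \<union> V) = A \<union> B" using un(1,2) by blast
    moreover have "is_lozenge l" if "l \<in> U \<union> V" for l using UV(2,3) that by (auto simp: tilings_def)
    ultimately have "U \<union> V \<in> tilings (A \<union> B)"
      using un(3,4) unfolding tilings_def partition_on_def by blast
    moreover have "\<forall>l \<in> U \<union> V. l \<subseteq> A \<or> l \<subseteq> B" using sub(1) sub'(1) by blast
    ultimately show "(\<lambda>(U, V). U \<union> V) UV \<in> ?S"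
      by (simp add: UV(1))
  qed auto
  finally show ?thesis .
qed

section \<open>The factorization theorem\<close>

text \<open>The weight 1/2 described by position alone; \<open>zigzag_weight_trimmed\<close>
  identifies it with the weight along the zigzags.\<close>

definition axis_weight :: "triangle set \<Rightarrow> real" where
  "axis_weight l = (if l \<subseteq> {t. cx t = 0} then 1 / 2 else 1)"

locale mirror_region =
  fixes R :: "triangle set" and c :: int
  assumes finite_region: "finite R"
    and region_lattice: "R \<subseteq> faces_in (lattice c)"
    and region_mirror: "t \<in> R \<Longrightarrow> mirror t \<in> R"
begin

text \<open>\<open>Ax\<close> and \<open>rk\<close> restate \<open>axis\<close> and
  \<open>rank\<close> without reference to a matching, so that they can be shared by all matchings
  of the region.\<close>

definition Ax :: "triangle set" where "Ax = {t \<in> R. cx t = 0}"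

definition rk :: "triangle \<Rightarrow> nat" where "rk v = card {u \<in> Ax. strip u < strip v}"

definition Ax0 :: "triangle set" where "Ax0 = {v \<in> Ax. even (rk v)}"

lemma finite_Ax: "finite Ax"
  using finite_region by (simp add: Ax_def)

lemma matching:
  assumes "\<mu> \<in> matchings R" shows "mirrored_matching R cx strip mirror \<mu>"
proof
  note D = matchingsD[OF assms]
  show "s = t" if "s \<in> R" "t \<in> R" "cx s = cx t" "strip s = strip t" for s t
    using that region_lattice lattice_coord_inj by blast
  show "\<bar>cx t - cx (\<mu> t)\<bar> + \<bar>strip t - strip (\<mu> t)\<bar> = 1" if "t \<in> R" for t
    by (rule lozenge_step[OF D(4)[OF that]])
qed (use finite_region region_mirror matchingsD[OF assms] in auto)

abbreviation comp :: "(triangle \<Rightarrow> triangle) \<Rightarrow> triangle \<Rightarrow> triangle set" where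
  "comp \<equiv> mirrored_matching.comp mirror"

lemma axis_eq: "\<mu> \<in> matchings R \<Longrightarrow> mirrored_matching.axis R cx = Ax"
  by (simp add: mirrored_matching.axis_def[OF matching] Ax_def)

lemma rank_eq: "\<mu> \<in> matchings R \<Longrightarrow> mirrored_matching.rank R cx strip v = rk v"
  by (simp add: mirrored_matching.rank_def[OF matching] rk_def axis_eq)

lemma mirror_Ax: "v \<in> Ax \<Longrightarrow> mirror v = v"
  by (cases v) (auto simp: Ax_def)

lemma partner:
  assumes "\<mu> \<in> matchings R" "v \<in> Ax"
  shows "\<exists>w \<in> Ax. comp \<mu> v \<inter> Ax = {v, w} \<and> odd (rk v + rk w) \<and>
    (cx (\<mu> v) \<noteq> 0 \<longrightarrow> cx (\<mu> w) \<noteq> 0 \<and>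
      ((cx (\<mu> w) > 0 \<longleftrightarrow> cx (\<mu> v) > 0) \<longleftrightarrow> odd (strip v + strip w)))"
proof -
  interpret m: mirrored_matching R cx strip mirror \<mu> by (rule matching[OF assms(1)])
  note eq = axis_eq[OF assms(1)] rank_eq[OF assms(1)]
  obtain w where w: "w \<in> Ax" "w \<noteq> v" "comp \<mu> v \<inter> Ax = {v, w}"
    "cx (\<mu> v) \<noteq> 0 \<Longrightarrow> cx (\<mu> w) \<noteq> 0"
    "cx (\<mu> v) \<noteq> 0 \<Longrightarrow> (cx (\<mu> w) > 0 \<longleftrightarrow> cx (\<mu> v) > 0) \<longleftrightarrow> odd (strip v + strip w)"
    using m.comp_axis[unfolded eq, OF assms(2)] by metis
  moreover have "odd (rk v + rk w)"
    using m.rank_parity[unfolded eq, OF assms(2) w(3)] w(2) by simp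
  ultimately show ?thesis by blast
qed

section \<open>Flipping components\<close>

definition flip :: "triangle \<Rightarrow> (triangle \<Rightarrow> triangle) \<Rightarrow> triangle \<Rightarrow> triangle" where
  "flip v \<mu> t = (if t \<in> comp \<mu> v then mirror (\<mu> (mirror t)) else \<mu> t)"

text \<open>A flip exchanges \<open>\<mu>\<close> and \<open>nu\<close> on the component of
  \<open>v\<close> and thereby leaves the component unchanged as a set; so a second flip undoes the
  first.\<close>

lemma flip_matching:
  assumes \<mu>: "\<mu> \<in> matchings R" and v: "v \<in> Ax"
  shows "flip v \<mu> \<in> matchings R" "flip v (flip v \<mu>) = \<mu>"
proof -
  interpret m: mirrored_matching R cx strip mirror \<mu> by (rule matching[OF \<mu>])
  note D = matchingsD[OF \<mu>]
  have vR: "v \<in> R" and vA: "v \<in> m.axis" using v by (auto simp: Ax_def axis_eq[OF \<mu>])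
  have C: "t \<in> R" "mirror t \<in> m.comp v" "\<mu> t \<in> m.comp v" "m.nu t \<in> m.comp v" if "t \<in> m.comp v" for t
    using m.comp_subset[OF vR that] m.sigma_comp[OF vA that] that by (auto intro: m.comp.intros)
  have C': "t \<in> m.comp v \<longleftrightarrow> mirror t \<in> m.comp v" for t using C(2)[of t] C(2)[of "mirror t"] by auto
  have f1: "flip v \<mu> t = m.nu t" if "t \<in> m.comp v" for t using that by (simp add: flip_def m.nu_def)
  have f2: "flip v \<mu> t = \<mu> t" if "t \<notin> m.comp v" for t using that by (simp add: flip_def)
  show fm: "flip v \<mu> \<in> matchings R"
    unfolding matchings_def
  proof (intro CollectI conjI allI impI ballI)
    fix t assume "t \<notin> R"
    then show "flip v \<mu> t = t" using f2[of t] C(1) D(1) by auto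
  next
    fix t assume t: "t \<in> R"
    show "flip v \<mu> t \<in> R" using t f1 f2 by (cases "t \<in> m.comp v") auto
    show "flip v \<mu> (flip v \<mu> t) = t"
    proof (cases "t \<in> m.comp v")
      case True then show ?thesis using t by (simp add: f1 C(4))
    next
      case False
      then have "\<mu> t \<notin> m.comp v" using t m.comp_mu_iff[OF vR] by simp
      then show ?thesis using t False by (simp add: f2)
    qed
    show "is_lozenge {t, flip v \<mu> t}"
    proof (cases "t \<in> m.comp v")
      case True
      then show ?thesis
        using D(4)[of "mirror t"] lozenge_mirror[of "mirror t" "\<mu> (mirror t)"] t
        by (simp add: flip_def)
    qed (use t D(4) in \<open>simp add: f2\<close>)
  qed
  interpret m': mirrored_matching R cx strip mirror "flip v \<mu>" by (rule matching[OF fm])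
  have nu': "m'.nu t = (if t \<in> m.comp v then \<mu> t else m.nu t)" for t
    using C'[of t] by (auto simp: m'.nu_def m.nu_def flip_def)
  have "m'.comp v \<subseteq> m.comp v"
    by (rule m'.comp_subsetI) (auto simp: nu' f1 intro: m.comp.intros)
  moreover have "m.comp v \<subseteq> m'.comp v \<inter> m.comp v"
  proof (rule m.comp_subsetI)
    fix t assume t: "t \<in> m'.comp v \<inter> m.comp v"
    show "\<mu> t \<in> m'.comp v \<inter> m.comp v"
      using t m'.comp.nu[of t v] nu'[of t] by (auto intro: m.comp.intros)
    show "m.nu t \<in> m'.comp v \<inter> m.comp v"
      using t m'.comp.mu[of t v] f1[of t] by (auto intro: m.comp.intros)
  qed (auto intro: m.comp.intros m'.comp.intros)
  ultimately have comp': "m'.comp v = m.comp v" by blast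
  show "flip v (flip v \<mu>) = \<mu>"
  proof
    fix t
    show "flip v (flip v \<mu>) t = \<mu> t"
    proof (cases "t \<in> m.comp v")
      case True
      then show ?thesis unfolding flip_def[of v "flip v \<mu>"] comp' using C' by (simp add: flip_def)
    next
      case False
      then show ?thesis unfolding flip_def[of v "flip v \<mu>"] comp' by (simp add: f2)
    qed
  qed
qed

text \<open>For \<open>u\<close> on the axis, the gains of a matching and of its flip at
  \<open>u\<close> add up to 1: the flip moves the partner of \<open>u\<close> to the other side, or
  \<open>u\<close> lies in a lozenge on the axis and both gains are 1/2.\<close>

definition gain :: "triangle set \<Rightarrow> (triangle \<Rightarrow> triangle) \<Rightarrow> triangle \<Rightarrow> real" where
  "gain K \<mu> u = (if cx (\<mu> u) = 0 then 1 / 2 else if cx (\<mu> u) > 0 \<longleftrightarrow> u \<in> K then 1 else 0)"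

text \<open>Every component that meets the axis contains exactly one element of \<open>Ax0\<close>; flipping it changes
  the side to which that element is matched and does not affect the other elements of \<open>Ax0\<close>.\<close>

lemma halving:
  assumes "X \<subseteq> Ax0" "v \<in> Ax0" "v \<notin> X"
  shows "(\<Sum>\<mu>\<in>matchings R. \<Prod>u\<in>X. gain K \<mu> u) = 2 * (\<Sum>\<mu>\<in>matchings R. \<Prod>u\<in>insert v X. gain K \<mu> u)"
proof -
  have vA: "v \<in> Ax" using assms by (simp add: Ax0_def)
  have fX: "finite X" using assms(1) finite_Ax by (auto simp: Ax0_def intro: finite_subset)
  have g_v: "gain K \<mu> v + gain K (flip v \<mu>) v = 1" if \<mu>: "\<mu> \<in> matchings R" for \<mu>
  proof -
    interpret m: mirrored_matching R cx strip mirror \<mu> by (rule matching[OF \<mu>])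
    have "flip v \<mu> v = mirror (\<mu> v)" using m.comp.base mirror_Ax[OF vA] by (simp add: flip_def)
    then show ?thesis by (auto simp: gain_def)
  qed
  have g_X: "gain K (flip v \<mu>) u = gain K \<mu> u" if \<mu>: "\<mu> \<in> matchings R" and u: "u \<in> X" for \<mu> u
  proof -
    obtain w where w: "w \<in> Ax" "comp \<mu> v \<inter> Ax = {v, w}" "odd (rk v + rk w)"
      using partner[OF \<mu> vA] by blast
    have "u \<in> Ax" "even (rk u)" "u \<noteq> v" using u assms by (auto simp: Ax0_def)
    moreover have "odd (rk w)" using w(3) assms(2) by (simp add: Ax0_def)
    ultimately have "u \<notin> comp \<mu> v" using w(2) by auto
    then show ?thesis by (simp add: gain_def flip_def)
  qed
  have bij: "bij_betw (flip v) (matchings R) (matchings R)"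
    by (rule bij_betw_byWitness[where f' = "flip v"]) (use flip_matching vA in auto)
  let ?F = "\<lambda>\<mu>. \<Prod>u\<in>insert v X. gain K \<mu> u"
  have "(\<Sum>\<mu>\<in>matchings R. \<Prod>u\<in>X. gain K \<mu> u) = (\<Sum>\<mu>\<in>matchings R. ?F \<mu> + ?F (flip v \<mu>))"
  proof (rule sum.cong)
    fix \<mu> assume \<mu>: "\<mu> \<in> matchings R"
    have "(\<Prod>u\<in>X. gain K (flip v \<mu>) u) = (\<Prod>u\<in>X. gain K \<mu> u)"
      by (rule prod.cong) (use g_X[OF \<mu>] in auto)
    then show "(\<Prod>u\<in>X. gain K \<mu> u) = ?F \<mu> + ?F (flip v \<mu>)"
      using g_v[OF \<mu>] assms(3) fX by (simp add: distrib_right[symmetric])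
  qed simp
  also have "\<dots> = (\<Sum>\<mu>\<in>matchings R. ?F \<mu>) + (\<Sum>\<mu>\<in>matchings R. ?F (flip v \<mu>))"
    by (rule sum.distrib)
  also have "(\<Sum>\<mu>\<in>matchings R. ?F (flip v \<mu>)) = (\<Sum>\<mu>\<in>matchings R. ?F \<mu>)"
    by (rule sum.reindex_bij_betw[OF bij])
  finally show ?thesis by simp
qed

lemma card_matchings_gain:
  "real (card (matchings R)) = 2 ^ card Ax0 * (\<Sum>\<mu>\<in>matchings R. \<Prod>u\<in>Ax0. gain K \<mu> u)"
proof -
  have "real (card (matchings R)) = 2 ^ card X * (\<Sum>\<mu>\<in>matchings R. \<Prod>u\<in>X. gain K \<mu> u)"
    if "finite X" "X \<subseteq> Ax0" for X
    using that
  proof (induction X rule: finite_induct)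
    case (insert v X)
    then show ?case using halving[of X v K] by simp
  qed simp
  moreover have "finite Ax0" using finite_Ax by (simp add: Ax0_def)
  ultimately show ?thesis by blast
qed

text \<open>The ranks are exactly the numbers below \<open>2 * n\<close>, each taken once.\<close>

lemma card_Ax0:
  assumes "card Ax = 2 * n" shows "card Ax0 = n"
proof -
  have less: "rk u < rk v" if "u \<in> Ax" "v \<in> Ax" "strip u < strip v" for u v
    unfolding rk_def using that finite_Ax by (intro psubset_card_mono) auto
  have inj: "inj_on rk Ax"
  proof (rule inj_onI)
    fix u v assume "u \<in> Ax" "v \<in> Ax" "rk u = rk v"
    then have "strip u = strip v" using less by (metis less_irrefl linorder_neqE)
    then show "u = v" using \<open>u \<in> Ax\<close> \<open>v \<in> Ax\<close> region_lattice lattice_coord_inj[of u c v]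
      by (auto simp: Ax_def)
  qed
  have "rk u < 2 * n" if "u \<in> Ax" for u
    unfolding rk_def assms[symmetric] using that finite_Ax by (intro psubset_card_mono) auto
  then have sub: "rk ` Ax \<subseteq> {..<2 * n}" by auto
  have "rk ` Ax = {..<2 * n}"
    by (rule card_subset_eq[OF _ sub]) (simp_all add: card_image[OF inj] assms)
  moreover have "rk ` Ax0 = {i \<in> rk ` Ax. even i}" by (auto simp: Ax0_def)
  ultimately have "rk ` Ax0 = {i. i < 2 * n \<and> even i}" by simp
  also have "\<dots> = (\<lambda>i. 2 * i) ` {..<n}" by (auto elim!: evenE)
  finally have "card (rk ` Ax0) = n" by (simp add: card_image inj_on_def)
  then show ?thesis using card_image[OF inj_on_subset[OF inj], of Ax0] by (auto simp: Ax0_def)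
qed

text \<open>\<open>K\<close> collects the axis triangles that are to be matched eastwards. With
  ranks of opposite parity, membership of two axis triangles in \<open>K\<close> agrees exactly if
  their strips have different parity, which is the rule that \<open>partner\<close> gives for the
  sides; \<open>e\<close> leaves open which of the two classes is \<open>K\<close>.\<close>

context
  fixes K :: "triangle set" and e :: int
  assumes K_sub: "K \<subseteq> Ax"
    and K_iff: "\<And>v. v \<in> Ax \<Longrightarrow> v \<in> K \<longleftrightarrow> even (int (rk v) + strip v + e)"
begin

section \<open>Matchings with prescribed sides\<close>

lemma K_pair:
  assumes "v \<in> Ax" "w \<in> Ax" "odd (rk v + rk w)"
  shows "(v \<in> K \<longleftrightarrow> w \<in> K) \<longleftrightarrow> odd (strip v + strip w)"
  using K_iff[OF assms(1)] K_iff[OF assms(2)] assms(3) by simp blast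

definition consistent :: "(triangle \<Rightarrow> triangle) \<Rightarrow> bool" where
  "consistent \<mu> \<longleftrightarrow> (\<forall>u\<in>Ax. cx (\<mu> u) = 0 \<or> (cx (\<mu> u) > 0 \<longleftrightarrow> u \<in> K))"

text \<open>Rank and strip both change parity along a lozenge on the axis, so its two triangles
  belong to the same half.\<close>

lemma axis_lozenge:
  assumes "\<mu> \<in> matchings R" "u \<in> Ax" "cx (\<mu> u) = 0"
  shows "\<mu> u \<in> Ax" "odd (rk u + rk (\<mu> u))" "u \<in> K \<longleftrightarrow> \<mu> u \<in> K"
proof -
  interpret m: mirrored_matching R cx strip mirror \<mu> by (rule matching[OF assms(1)])
  have uR: "u \<in> R" "cx u = 0" using assms(2) by (auto simp: Ax_def)
  show A: "\<mu> u \<in> Ax" using uR assms matchingsD(2)[OF assms(1)] by (simp add: Ax_def)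
  have "\<mu> u \<in> comp \<mu> u" "\<mu> u \<noteq> u"
    using matchingsD(5)[OF assms(1) uR(1)] by (auto intro: m.comp.intros)
  moreover obtain w where w: "w \<in> Ax" "comp \<mu> u \<inter> Ax = {u, w}" "odd (rk u + rk w)"
    using partner[OF assms(1,2)] by blast
  ultimately have "w = \<mu> u" using A by blast
  then show o: "odd (rk u + rk (\<mu> u))" using w by simp
  have "odd (strip u + strip (\<mu> u))"
    using unit_step_parity[OF m.mu_step[OF uR(1)]] uR assms(3) by simp
  then show "u \<in> K \<longleftrightarrow> \<mu> u \<in> K" using K_pair[OF assms(2) A o] by simp
qed

text \<open>A triangle of odd rank inherits the condition from its partner, which has even rank,
  because \<open>K_pair\<close> and \<open>partner\<close> follow the same rule.\<close>

lemma consistent_iff: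
  assumes \<mu>: "\<mu> \<in> matchings R"
  shows "consistent \<mu> \<longleftrightarrow> (\<forall>u\<in>Ax0. gain K \<mu> u \<noteq> 0)"
proof
  assume "\<forall>u\<in>Ax0. gain K \<mu> u \<noteq> 0"
  then have good: "cx (\<mu> u) = 0 \<or> (cx (\<mu> u) > 0 \<longleftrightarrow> u \<in> K)" if "u \<in> Ax0" for u
    using that by (auto simp: gain_def split: if_splits)
  show "consistent \<mu>"
    unfolding consistent_def
  proof
    fix u assume u: "u \<in> Ax"
    obtain w where w: "w \<in> Ax" "comp \<mu> u \<inter> Ax = {u, w}" "odd (rk u + rk w)"
      "cx (\<mu> u) \<noteq> 0 \<Longrightarrow> cx (\<mu> w) \<noteq> 0"
      "cx (\<mu> u) \<noteq> 0 \<Longrightarrow> (cx (\<mu> w) > 0 \<longleftrightarrow> cx (\<mu> u) > 0) \<longleftrightarrow> odd (strip u + strip w)"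
      using partner[OF \<mu> u] by blast
    show "cx (\<mu> u) = 0 \<or> (cx (\<mu> u) > 0 \<longleftrightarrow> u \<in> K)"
    proof (cases "even (rk u)")
      case False
      then have "w \<in> Ax0" using w by (simp add: Ax0_def)
      then show ?thesis using good[of w] w(4,5) K_pair[OF u w(1,3)] by blast
    qed (use good u in \<open>simp add: Ax0_def\<close>)
  qed
qed (auto simp: consistent_def gain_def Ax0_def)

text \<open>Each lozenge on the axis contains exactly one triangle of even rank, so its weight 1/2
  is contributed exactly once; all other gains are 1.\<close>

lemma gain_axis_weight:
  assumes \<mu>: "\<mu> \<in> matchings R" and con: "consistent \<mu>"
  shows "(\<Prod>u\<in>Ax0. gain K \<mu> u) = (\<Prod>l\<in>tiles R \<mu>. axis_weight l)"
proof -
  note D = matchingsD[OF \<mu>]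
  define Z where "Z = {u \<in> Ax0. cx (\<mu> u) = 0}"
  have fin: "finite Ax0" "finite (tiles R \<mu>)" using finite_Ax finite_region by (auto simp: Ax0_def tiles_def)
  have "(\<Prod>u\<in>Ax0. gain K \<mu> u) = (\<Prod>u\<in>Z. 1 / 2)"
    unfolding Z_def using con fin(1)
    by (intro prod.mono_neutral_cong_right) (auto simp: gain_def consistent_def Ax0_def)
  also have "\<dots> = (\<Prod>u\<in>Z. axis_weight {u, \<mu> u})"
    by (rule prod.cong) (auto simp: Z_def axis_weight_def Ax0_def Ax_def)
  also have "\<dots> = (\<Prod>l\<in>(\<lambda>u. {u, \<mu> u}) ` Z. axis_weight l)"
  proof (subst prod.reindex)
    show "inj_on (\<lambda>u. {u, \<mu> u}) Z"
    proof (rule inj_onI)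
      fix u v assume uv: "u \<in> Z" "v \<in> Z" "{u, \<mu> u} = {v, \<mu> v}"
      have "odd (rk v + rk (\<mu> v))" using axis_lozenge(2)[OF \<mu>, of v] uv(2) by (auto simp: Z_def Ax0_def)
      then have "u \<noteq> \<mu> v" using uv by (auto simp: Z_def Ax0_def)
      then show "u = v" using uv(3) by (metis doubleton_eq_iff)
    qed
  qed simp
  also have "\<dots> = (\<Prod>l\<in>tiles R \<mu>. axis_weight l)"
  proof (rule prod.mono_neutral_left[OF fin(2)])
    show "(\<lambda>u. {u, \<mu> u}) ` Z \<subseteq> tiles R \<mu>" by (auto simp: Z_def Ax0_def Ax_def tiles_def)
    show "\<forall>l\<in>tiles R \<mu> - (\<lambda>u. {u, \<mu> u}) ` Z. axis_weight l = 1"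
    proof
      fix l assume l: "l \<in> tiles R \<mu> - (\<lambda>u. {u, \<mu> u}) ` Z"
      then obtain t where t: "t \<in> R" "l = {t, \<mu> t}" by (auto simp: tiles_def)
      show "axis_weight l = 1"
      proof (rule ccontr)
        assume "axis_weight l \<noteq> 1"
        then have "cx t = 0" "cx (\<mu> t) = 0" using t by (auto simp: axis_weight_def split: if_splits)
        then have A: "t \<in> Ax" "cx (\<mu> t) = 0" using t by (auto simp: Ax_def)
        note ax = axis_lozenge[OF \<mu> A]
        have "t \<in> Z \<or> \<mu> t \<in> Z"
          using ax A t D(3) by (auto simp: Z_def Ax0_def Ax_def)
        moreover have "l = {\<mu> t, \<mu> (\<mu> t)}" using t D(3) by auto
        ultimately show False using l t by blast
      qed
    qed
  qed
  finally show ?thesis .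
qed

text \<open>Along a lozenge \<open>cx\<close> changes by at most 1, so a lozenge without axis
  triangles cannot change sides. For one with a single axis triangle, the condition says that this
  triangle is assigned to the side of its partner.\<close>

lemma consistent_split:
  assumes \<mu>: "\<mu> \<in> matchings R"
  defines "P \<equiv> {t \<in> R. cx t > 0} \<union> K" and "Q \<equiv> {t \<in> R. cx t < 0} \<union> (Ax - K)"
  shows "consistent \<mu> \<longleftrightarrow> (\<forall>l\<in>tiles R \<mu>. l \<subseteq> P \<or> l \<subseteq> Q)"
proof -
  interpret m: mirrored_matching R cx strip mirror \<mu> by (rule matching[OF \<mu>])
  note D = matchingsD[OF \<mu>]
  show ?thesis
  proof
    assume con: "consistent \<mu>"
    have main: "{t, \<mu> t} \<subseteq> P \<or> {t, \<mu> t} \<subseteq> Q" if t: "t \<in> Ax" for t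
    proof (cases "cx (\<mu> t) = 0")
      case True
      then show ?thesis using axis_lozenge[OF \<mu> t True] t by (auto simp: P_def Q_def)
    next
      case False
      then have "cx (\<mu> t) > 0 \<longleftrightarrow> t \<in> K" using con t by (auto simp: consistent_def)
      moreover have "\<mu> t \<in> R" using t D(2) by (simp add: Ax_def)
      ultimately show ?thesis using t False by (auto simp: P_def Q_def)
    qed
    show "\<forall>l\<in>tiles R \<mu>. l \<subseteq> P \<or> l \<subseteq> Q"
    proof
      fix l assume "l \<in> tiles R \<mu>"
      then obtain t where t: "t \<in> R" "l = {t, \<mu> t}" by (auto simp: tiles_def)
      have mt: "\<mu> t \<in> R" "\<mu> (\<mu> t) = t" using t D by auto
      consider "t \<in> Ax" | "\<mu> t \<in> Ax" | "cx t \<noteq> 0" "cx (\<mu> t) \<noteq> 0" using t mt by (auto simp: Ax_def)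
      then show "l \<subseteq> P \<or> l \<subseteq> Q"
      proof cases
        case 2
        then show ?thesis using main[OF 2] mt t by (simp add: insert_commute)
      next
        case 3
        then have "cx t > 0 \<longleftrightarrow> cx (\<mu> t) > 0" using m.mu_step[OF t(1)] by linarith
        then show ?thesis using 3 t mt by (auto simp: P_def Q_def)
      qed (use main t in simp)
    qed
  next
    assume *: "\<forall>l\<in>tiles R \<mu>. l \<subseteq> P \<or> l \<subseteq> Q"
    show "consistent \<mu>"
      unfolding consistent_def
    proof
      fix u assume u: "u \<in> Ax"
      then have "{u, \<mu> u} \<subseteq> P \<or> {u, \<mu> u} \<subseteq> Q" using * by (auto simp: tiles_def Ax_def)
      moreover have "\<mu> u \<in> Ax" if "\<mu> u \<in> K" using that K_sub by blast
      ultimately show "cx (\<mu> u) = 0 \<or> (cx (\<mu> u) > 0 \<longleftrightarrow> u \<in> K)"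
        using u by (auto simp: P_def Q_def Ax_def)
    qed
  qed
qed

theorem factorization:
  assumes "card Ax = 2 * n"
  shows "M (R, \<lambda>l. 1) = 2 ^ n * M ({t \<in> R. cx t > 0} \<union> K, axis_weight)
    * M ({t \<in> R. cx t > 0} \<union> (Ax - K), axis_weight)"
proof -
  define P where "P = {t \<in> R. cx t > 0} \<union> K"
  define Q where "Q = {t \<in> R. cx t < 0} \<union> (Ax - K)"
  have PQ: "P \<union> Q = R" "P \<inter> Q = {}" "finite P" "finite Q"
    using K_sub finite_region finite_subset[OF K_sub finite_Ax] finite_Ax by (auto simp: P_def Q_def Ax_def)
  \<comment> \<open>The western half is replaced by its mirror image, so that both factors are
    eastern halves that differ only in their axis triangles.\<close>
  have Q: "Q = mirror ` ({t \<in> R. cx t > 0} \<union> (Ax - K))"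
  proof -
    have "mirror ` {t \<in> R. cx t > 0} = {t \<in> R. cx t < 0}"
    proof (intro equalityI subsetI)
      fix t assume "t \<in> {t \<in> R. cx t < 0}"
      then show "t \<in> mirror ` {t \<in> R. cx t > 0}"
        using region_mirror[of t] by (intro image_eqI[of _ _ "mirror t"]) auto
    qed (use region_mirror in auto)
    moreover have "mirror ` (Ax - K) = Ax - K" using mirror_Ax by (auto simp: image_iff)
    ultimately show ?thesis by (simp add: Q_def image_Un)
  qed
  have fin: "finite (matchings R)" by (rule finite_matchings[OF finite_region])
  have "(\<Sum>\<mu>\<in>matchings R. \<Prod>u\<in>Ax0. gain K \<mu> u)
      = (\<Sum>\<mu> | \<mu> \<in> matchings R \<and> consistent \<mu>. \<Prod>l\<in>tiles R \<mu>. axis_weight l)"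
  proof (rule sum.mono_neutral_cong_right)
    show "\<forall>\<mu>\<in>matchings R - {\<mu>. \<mu> \<in> matchings R \<and> consistent \<mu>}. (\<Prod>u\<in>Ax0. gain K \<mu> u) = 0"
      using consistent_iff finite_Ax by (auto simp: Ax0_def)
  qed (use fin gain_axis_weight in auto)
  also have "\<dots> = (\<Sum>T | T \<in> tilings R \<and> (\<forall>l\<in>T. l \<subseteq> P \<or> l \<subseteq> Q). \<Prod>l\<in>T. axis_weight l)"
  proof (rule sum.reindex_bij_betw)
    show "bij_betw (tiles R) {\<mu>. \<mu> \<in> matchings R \<and> consistent \<mu>} {T. T \<in> tilings R \<and> (\<forall>l\<in>T. l \<subseteq> P \<or> l \<subseteq> Q)}"
    proof -
      have "{T. T \<in> tilings R \<and> (\<forall>l\<in>T. l \<subseteq> P \<or> l \<subseteq> Q)} = tiles R ` {\<mu>. \<mu> \<in> matchings R \<and> consistent \<mu>}"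
      proof (intro equalityI subsetI)
        fix T assume T: "T \<in> {T. T \<in> tilings R \<and> (\<forall>l\<in>T. l \<subseteq> P \<or> l \<subseteq> Q)}"
        then obtain \<mu> where "\<mu> \<in> matchings R" "T = tiles R \<mu>"
          using bij_betw_imp_surj_on[OF bij_betw_tiles[of R]] by blast
        then show "T \<in> tiles R ` {\<mu>. \<mu> \<in> matchings R \<and> consistent \<mu>}"
          using T consistent_split[of \<mu>] by (auto simp: P_def Q_def)
      next
        fix T assume "T \<in> tiles R ` {\<mu>. \<mu> \<in> matchings R \<and> consistent \<mu>}"
        then show "T \<in> {T. T \<in> tilings R \<and> (\<forall>l\<in>T. l \<subseteq> P \<or> l \<subseteq> Q)}"
          using consistent_split tiles_in_tilings by (auto simp: P_def Q_def)
      qed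
      then show ?thesis using bij_betw_imp_inj_on[OF bij_betw_tiles[of R]]
        by (auto simp: bij_betw_def inj_on_def)
    qed
  qed
  also have "\<dots> = M (P, axis_weight) * M (Q, axis_weight)"
    using M_Un[OF PQ(3,4,2), of axis_weight] unfolding PQ(1) by simp
  also have "M (Q, axis_weight) = M ({t \<in> R. cx t > 0} \<union> (Ax - K), axis_weight)"
  proof -
    have "axis_weight (mirror ` l) = axis_weight l" for l by (auto simp: axis_weight_def)
    then show ?thesis unfolding Q by (subst M_image[OF inj_mirror lozenge_mirror]) simp
  qed
  finally have "(\<Sum>\<mu>\<in>matchings R. \<Prod>u\<in>Ax0. gain K \<mu> u) =
    M ({t \<in> R. cx t > 0} \<union> K, axis_weight) * M ({t \<in> R. cx t > 0} \<union> (Ax - K), axis_weight)"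
    by (simp only: P_def)
  moreover have "M (R, \<lambda>l. 1) = real (card (matchings R))"
    by (simp add: M_matchings)
  ultimately show ?thesis
    using card_matchings_gain[of K] card_Ax0[OF assms] by simp
qed

end
end

section \<open>The halves of the hexagon\<close>

lemma Up_in_faces_in: "Up p k \<in> faces_in P \<longleftrightarrow> (p, k) \<in> P \<and> (p + 2, k) \<in> P \<and> (p + 1, k + 1) \<in> P"
  by (auto simp: faces_in_def)

lemma Down_in_faces_in: "Down p k \<in> faces_in P \<longleftrightarrow> (p, k) \<in> P \<and> (p + 2, k) \<in> P \<and> (p + 1, k - 1) \<in> P"
  by (auto simp: faces_in_def)

lemmas in_faces_in = Up_in_faces_in Down_in_faces_in

section \<open>Forced lozenges\<close>

lemma M_pair:
  assumes "is_lozenge {s, t}" shows "M ({s, t}, w) = w {s, t}"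
proof -
  have "s \<noteq> t" using assms by (simp add: lozenge_pair_iff)
  have "tilings {s, t} = {{{s, t}}}"
  proof (intro equalityI subsetI)
    fix T assume T: "T \<in> tilings {s, t}"
    have "l = {s, t}" if "l \<in> T" for l
    proof -
      have "is_lozenge l" "l \<subseteq> {s, t}" using T that by (auto simp: tilings_def partition_on_def)
      moreover then obtain u v where "l = {u, v}" "u \<noteq> v" using lozenge_obtain by metis
      ultimately show ?thesis by auto
    qed
    moreover have "T \<noteq> {}" using T by (auto simp: tilings_def partition_on_def)
    ultimately show "T \<in> {{{s, t}}}" by blast
  qed (use assms in \<open>auto simp: tilings_def partition_on_def\<close>)
  then show ?thesis by (simp add: M_def)
qed

lemma M_forced_pair:
  assumes "finite R" "s \<in> R" "t \<in> R" "is_lozenge {s, t}" "w {s, t} = 1"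
    and only: "\<And>u. u \<in> R \<Longrightarrow> is_lozenge {s, u} \<Longrightarrow> u = t"
  shows "M (R, w) = M (R - {s, t}, w)"
proof -
  have un: "{s, t} \<union> (R - {s, t}) = R" using assms by blast
  have "\<forall>l\<in>T. l \<subseteq> {s, t} \<or> l \<subseteq> R - {s, t}" if T: "T \<in> tilings R" for T
  proof
    fix l assume l: "l \<in> T"
    have P: "partition_on R T" and L: "\<And>l. l \<in> T \<Longrightarrow> is_lozenge l" using T by (auto simp: tilings_def)
    obtain l' where l': "l' \<in> T" "s \<in> l'" using P assms(2) by (auto simp: partition_on_def)
    obtain u v where "l' = {u, v}" using lozenge_obtain[OF L[OF l'(1)]] by metis
    then obtain u' where u': "l' = {s, u'}" using l'(2) by (metis insertE insert_commute singletonD)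
    then have "u' \<in> R" using P l'(1) by (auto simp: partition_on_def)
    then have "l' = {s, t}" using only[of u'] L[OF l'(1)] u' by simp
    moreover have "l = l' \<or> l \<inter> l' = {}" using P l l'(1) by (auto simp: partition_on_def disjoint_def)
    moreover have "l \<subseteq> R" using P l by (auto simp: partition_on_def)
    ultimately show "l \<subseteq> {s, t} \<or> l \<subseteq> R - {s, t}" by blast
  qed
  then have "{T. T \<in> tilings R \<and> (\<forall>l\<in>T. l \<subseteq> {s, t} \<or> l \<subseteq> R - {s, t})} = tilings R" by blast
  moreover have "M ({s, t}, w) * M (R - {s, t}, w) =
    (\<Sum>T | T \<in> tilings R \<and> (\<forall>l\<in>T. l \<subseteq> {s, t} \<or> l \<subseteq> R - {s, t}). \<Prod>l\<in>T. w l)"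
    using M_Un[of "{s, t}" "R - {s, t}" w] assms(1) unfolding un by auto
  ultimately show ?thesis using M_pair[OF assms(4), of w] assms(5) by (simp add: M_def)
qed

text \<open>The pairs are peeled off from index 0 on: when \<open>f i\<close> is reached, every
  \<open>g j\<close> with \<open>j < i\<close> is already gone, and only \<open>g i\<close> is left
  for it.\<close>

lemma M_forced_pairs:
  fixes f g :: "nat \<Rightarrow> triangle"
  assumes "finite R"
    and "inj f" "inj g" "\<And>i j. f i \<noteq> g j"
    and "\<And>i. i < n \<Longrightarrow> f i \<in> R" "\<And>i. i < n \<Longrightarrow> g i \<in> R"
    and "\<And>i. i < n \<Longrightarrow> is_lozenge {f i, g i}" "\<And>i. i < n \<Longrightarrow> w {f i, g i} = 1"
    and only: "\<And>i u. i < n \<Longrightarrow> u \<in> R \<Longrightarrow> is_lozenge {f i, u} \<Longrightarrow> \<exists>j\<le>i. u = g j"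
  shows "M (R, w) = M (R - (f ` {..<n} \<union> g ` {..<n}), w)"
  using assms(5-)
proof (induction n)
  case (Suc n)
  let ?R = "R - (f ` {..<n} \<union> g ` {..<n})"
  have "M (R, w) = M (?R, w)" by (rule Suc.IH) (use Suc.prems in auto)
  also have "\<dots> = M (?R - {f n, g n}, w)"
  proof (rule M_forced_pair)
    show "f n \<in> ?R" "g n \<in> ?R"
      using Suc.prems(1,2)[of n] assms(2-4) by (auto simp: inj_eq) (metis assms(4))+
    show "u = g n" if u: "u \<in> ?R" "is_lozenge {f n, u}" for u
    proof -
      obtain j where "j \<le> n" "u = g j" using Suc.prems(5)[of n u] u by blast
      then show ?thesis using u(1) by (cases "j = n") auto
    qed
  qed (use Suc.prems assms(1) in auto)
  also have "?R - {f n, g n} = R - (f ` {..<Suc n} \<union> g ` {..<Suc n})"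
    by (auto simp: lessThan_Suc)
  finally show ?case .
qed simp

section \<open>Horizontal translations\<close>

fun tau :: "int \<Rightarrow> triangle \<Rightarrow> triangle" where
  "tau d (Up p k) = Up (p + d) k"
| "tau d (Down p k) = Down (p + d) k"

lemma tau_tau: "tau d (tau (- d) t) = t" "tau (- d) (tau d t) = t"
  by (cases t; simp)+

lemma inj_tau: "inj (tau d)"
  by (metis injI tau_tau(2))

lemma lozenge_tau: "is_lozenge {tau d s, tau d t} \<longleftrightarrow> is_lozenge {s, t}"
  by (cases s; cases t) (auto simp: lozenge_iffs)

lemma tau_image_eqI:
  assumes "\<And>t. tau d t \<in> B \<longleftrightarrow> t \<in> A" shows "tau d ` A = B"
proof (intro equalityI subsetI)
  fix t assume "t \<in> B"
  then have "tau (- d) t \<in> A" using assms[of "tau (- d) t"] by (simp add: tau_tau)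
  then show "t \<in> tau d ` A" by (metis image_eqI tau_tau(1))
qed (use assms in auto)

lemma tau_in_faces_in: "tau d t \<in> faces_in P \<longleftrightarrow> t \<in> faces_in {(p, k). (p + d, k) \<in> P}"
  by (cases t) (auto simp: in_faces_in add.assoc add.commute add.left_commute)

lemma tau_fern_triangle: "tau d ` fern_triangle i p s = fern_triangle i (p + d) s"
proof (rule tau_image_eqI)
  fix t
  have "{(q, k). (q + d, k) \<in> {(q, k). 0 \<le> k \<and> p + d + k \<le> q \<and> q \<le> p + d + 2 * int s - k}}
      = {(q, k). 0 \<le> k \<and> p + k \<le> q \<and> q \<le> p + 2 * int s - k}"
    "{(q, k). (q + d, k) \<in> {(q, k). k \<le> 0 \<and> p + d - k \<le> q \<and> q \<le> p + d + 2 * int s + k}}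
      = {(q, k). k \<le> 0 \<and> p - k \<le> q \<and> q \<le> p + 2 * int s + k}"
    by auto
  then show "tau d t \<in> fern_triangle i (p + d) s \<longleftrightarrow> t \<in> fern_triangle i p s"
    by (simp add: fern_triangle_def tau_in_faces_in)
qed

text \<open>The west boundary of an eastern half. It passes through the lattice points on the axis
  and, in between, swings to -1 to include the axis triangles (\<open>e\<close>) or to 1 to exclude
  them.\<close>

definition zz :: "bool \<Rightarrow> int \<Rightarrow> int \<Rightarrow> int" where
  "zz e W k = (if even (k - W) then 0 else if e then - 1 else 1)"

lemma zz_Up:
  assumes "even (p - k - W)"
  shows "zz e W k \<le> p \<and> zz e W k \<le> p + 2 \<and> zz e W (k + 1) \<le> p + 1 \<longleftrightarrow> 0 \<le> p \<or> p = - 1 \<and> e"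
proof (cases "even p")
  case True
  then have "even (k - W)" "odd (k + 1 - W)" using assms by auto
  then show ?thesis using True by (auto simp: zz_def)
next
  case False
  then have "odd (k - W)" "even (k + 1 - W)" using assms by auto
  moreover have "p \<noteq> 0" using False by auto
  ultimately show ?thesis by (auto simp: zz_def)
qed

lemma zz_Down:
  assumes "even (p - k - W)"
  shows "zz e W k \<le> p \<and> zz e W k \<le> p + 2 \<and> zz e W (k - 1) \<le> p + 1 \<longleftrightarrow> 0 \<le> p \<or> p = - 1 \<and> e"
proof (cases "even p")
  case True
  then have "even (k - W)" "odd (k - 1 - W)" using assms by auto
  then show ?thesis using True by (auto simp: zz_def)
next
  case False
  then have "odd (k - W)" "even (k - 1 - W)" using assms by auto
  moreover have "p \<noteq> 0" using False by auto
  ultimately show ?thesis by (auto simp: zz_def)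
qed

text \<open>The hexagon of \<open>S1\<close> in terms of the levels \<open>N\<close> and \<open>- Nb\<close> of its horizontal sides; \<open>F\<close> is the union
  of the triangles removed to the right of the axis.\<close>

locale half_setup =
  fixes W N Nb z :: int and a1 :: nat and F :: "triangle set"
  assumes a1_N: "int a1 \<le> N" and z0: "0 \<le> z" and z_Nb: "Nb = 0 \<or> z < Nb" and Nb0: "0 \<le> Nb"
    and N_W: "N \<le> W" and Nb_W: "Nb \<le> W + 2 * z"
    and W_a1: "even (W - int a1)"
    and F_right: "t \<in> F \<Longrightarrow> cx t > 0"
    and F_top: "t \<in> F \<Longrightarrow> 0 \<le> strip t \<Longrightarrow> strip t \<le> N - 2"
    and F_bot: "t \<in> F \<Longrightarrow> strip t < 0 \<Longrightarrow> - Nb + 1 \<le> strip t"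
begin

definition hex :: "triangle set" where
  "hex = faces_in (lattice W \<inter> {(p, k). - Nb \<le> k \<and> k \<le> N \<and> \<bar>p\<bar> + \<bar>k + z\<bar> \<le> W + z})"

definition center :: "triangle set" where
  "center = fern_triangle 1 (- int a1) a1"

definition Reg :: "triangle set" where
  "Reg = hex - center - F - mirror ` F"

text \<open>The flags concern the axis triangles above and below the line k = 0. Both set leads to
  \<open>W1\<close>, none to \<open>H2\<close>, only \<open>eu\<close> to \<open>N1\<close>, only
  \<open>el\<close> to \<open>N4\<close>.\<close>

definition half :: "bool \<Rightarrow> bool \<Rightarrow> triangle set" where
  "half eu el = {t \<in> Reg. cx t > 0} \<union> {t \<in> Reg. cx t = 0 \<and> (if strip t \<ge> 0 then eu else el)}"

text \<open>The level drops if the top strip begins in the west with a down-pointing triangle. That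
  triangle hangs from the north side and has a single neighbour, which forces the whole
  strip.\<close>

definition top_level :: "bool \<Rightarrow> int" where
  "top_level eu = (if even (N - W) = eu then N else N - 1)"

definition bot_level :: "bool \<Rightarrow> int" where
  "bot_level el = (if even (Nb - W) = el then Nb else Nb - 1)"

lemma finite_Reg: "finite Reg"
proof -
  have "finite (lattice W \<inter> {(p, k). - Nb \<le> k \<and> k \<le> N \<and> \<bar>p\<bar> + \<bar>k + z\<bar> \<le> W + z})"
    by (rule finite_subset[of _ "{- (W + z)..W + z} \<times> {- Nb..N}"]) auto
  then show ?thesis unfolding Reg_def hex_def using finite_faces_in by blast
qed

lemma finite_half: "finite (half eu el)"
  using finite_Reg by (simp add: half_def)

lemma Up_center: "Up p k \<in> center \<longleftrightarrow> 0 \<le> k \<and> - int a1 + k \<le> p \<and> p + 2 \<le> int a1 - k"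
  by (auto simp: center_def fern_triangle_def in_faces_in)

lemma Down_center: "Down p k \<in> center \<longleftrightarrow> 1 \<le> k \<and> - int a1 + k \<le> p \<and> p + 2 \<le> int a1 - k"
  by (auto simp: center_def fern_triangle_def in_faces_in)

lemma Up_hex:
  assumes "-1 \<le> p"
  shows "Up p k \<in> hex \<longleftrightarrow> even (p - k - W) \<and> - Nb \<le> k \<and> k < N
    \<and> p + 2 + \<bar>k + z\<bar> \<le> W + z \<and> p + 1 + \<bar>k + 1 + z\<bar> \<le> W + z"
  using assms by (auto simp: hex_def in_faces_in lattice_def)

lemma Down_hex:
  assumes "-1 \<le> p"
  shows "Down p k \<in> hex \<longleftrightarrow> even (p - k - W) \<and> - Nb < k \<and> k \<le> N
    \<and> p + 2 + \<bar>k + z\<bar> \<le> W + z \<and> p + 1 + \<bar>k - 1 + z\<bar> \<le> W + z"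
  using assms by (auto simp: hex_def in_faces_in lattice_def)

lemma not_mirror_F:
  assumes "0 \<le> cx t" shows "t \<notin> mirror ` F"
  using F_right assms by fastforce

lemma mem_half_iff: "t \<in> half eu el \<longleftrightarrow> t \<in> hex \<and> t \<notin> center \<and> t \<notin> F
    \<and> (cx t > 0 \<or> cx t = 0 \<and> (if strip t \<ge> 0 then eu else el))"
  using not_mirror_F[of t] by (auto simp: half_def Reg_def)

text \<open>The halved regions lack the outermost strip of the half hexagon for one of the two parities of its
  level; in that case the strip can only be tiled by a row of forced lozenges.\<close>

lemma forced_top:
  assumes "even (N - W) \<noteq> eu" "1 \<le> N"
  shows "M (half eu el, axis_weight) = M (half eu el - {t. strip t = N - 1}, axis_weight)"
proof -
  \<comment> \<open>\<open>p0\<close> is the position of the westernmost triangle: on the axis or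
    next to it. The bound W - N in \<open>n\<close> is the east end of the north side.\<close>
  define p0 :: int where "p0 = (if eu then - 1 else 0)"
  define n where "n = nat ((W - N - p0) div 2)"
  define f g where "f i = Down (p0 + 2 * int i) N" and "g i = Up (p0 + 2 * int i + 1) (N - 1)" for i
  have par: "even (p0 - N - W)" "even (W - N - p0)" using assms(1) by (auto simp: p0_def)
  have n: "i < n \<longleftrightarrow> p0 + 2 * int i + 2 \<le> W - N" for i
    using par(2) unfolding n_def by (auto elim!: evenE)
  have p0: "p0 \<ge> - 1" by (simp add: p0_def)
  \<comment> \<open>A central triangle that reached the north side would contain the axis triangle
    of the top strip; if axis triangles are kept, parity rules this out.\<close>
  have ne: "int a1 < N" if eu using assms(1) W_a1 a1_N that by (metis even_diff dvd_diff_commute linorder_not_le order_antisym)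
  have F: "t \<notin> F" if "strip t = N - 1" for t using F_top[of t] that assms(2) by auto
  have fg: "f i \<in> half eu el" "g i \<in> half eu el" if "i < n" for i
  proof -
    have "Down (p0 + 2 * int i) N \<in> hex" "Up (p0 + 2 * int i + 1) (N - 1) \<in> hex"
      using that p0 par N_W z0 Nb0 assms(2) unfolding n by (auto simp: Up_hex Down_hex)
    moreover have "Down (p0 + 2 * int i) N \<notin> center" "Up (p0 + 2 * int i + 1) (N - 1) \<notin> center"
      using a1_N p0 ne by (auto simp: Down_center Up_center p0_def)
    ultimately show "f i \<in> half eu el" "g i \<in> half eu el"
      using F assms(2) by (auto simp: mem_half_iff f_def g_def p0_def)
  qed
  have row: "\<exists>i. t = f i \<and> i < n \<or> t = g i \<and> i < n" if t: "t \<in> half eu el" "strip t = N - 1" for t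
  proof (cases t)
    case (Up q k)
    then have k: "k = N - 1" and h: "t \<in> hex" "0 \<le> q \<or> q = -1 \<and> eu" using t assms(2) by (auto simp: mem_half_iff split: if_splits)
    then have q: "even (q - k - W)" "q + 2 + (k + z) \<le> W + z"
      using Up_hex[of q k] Up z0 assms(2) by auto
    have q1: "p0 + 1 \<le> q" "even (q - p0 - 1)" using q(1) h(2) par assms(1) k by (cases "q = 0"; auto simp: p0_def)+
    obtain j where j: "q - p0 - 1 = 2 * j" using q1(2) by (rule evenE)
    then have "t = g (nat j)" "nat j < n" using q(2) k q1 Up unfolding n by (auto simp: g_def)
    then show ?thesis by blast
  next
    case (Down q k)
    then have k: "k = N" and h: "t \<in> hex" "0 \<le> q \<or> q = -1 \<and> eu" using t assms(2) by (auto simp: mem_half_iff split: if_splits)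
    then have q: "even (q - k - W)" "q + 2 + (k + z) \<le> W + z"
      using Down_hex[of q k] Down z0 assms(2) by auto
    have q1: "p0 \<le> q" "even (q - p0)" using q(1) h(2) par assms(1) k by (cases "q = 0"; auto simp: p0_def)+
    obtain j where j: "q - p0 = 2 * j" using q1(2) by (rule evenE)
    then have "t = f (nat j)" "nat j < n" using q(2) k q1 Down unfolding n by (auto simp: f_def)
    then show ?thesis by blast
  qed
  have "half eu el \<inter> {t. strip t = N - 1} = f ` {..<n} \<union> g ` {..<n}"
    using row fg by (auto simp: f_def g_def)
  then have "half eu el - {t. strip t = N - 1} = half eu el - (f ` {..<n} \<union> g ` {..<n})" by blast
  moreover have "M (half eu el, axis_weight) = M (half eu el - (f ` {..<n} \<union> g ` {..<n}), axis_weight)"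
  proof (rule M_forced_pairs[OF finite_half])
    fix i u assume i: "i < n" and u: "u \<in> half eu el" "is_lozenge {f i, u}"
    show "\<exists>j\<le>i. u = g j"
    proof (cases u)
      case (Up q k)
      have "k \<noteq> N" using u(1) Up Up_hex[of q k] by (auto simp: mem_half_iff)
      then have k: "k = N - 1" and q: "q = p0 + 2 * int i + 1 \<or> q = p0 + 2 * int i - 1"
        using u(2) Up by (auto simp: f_def lozenge_iffs)
      \<comment> \<open>The western neighbour of \<open>f 0\<close> lies on or west of the axis and
        does not belong to the half.\<close>
      have "q \<noteq> p0 - 1" using u(1) Up assms(2) k by (auto simp: mem_half_iff p0_def split: if_splits)
      then consider "u = g i" | "i > 0" "u = g (i - 1)" using q Up k by (cases "i = 0") (auto simp: g_def of_nat_diff)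
      then show ?thesis
      proof cases
        case 1
        then show ?thesis by (intro exI[of _ i]) simp
      next
        case 2
        then show ?thesis by (intro exI[of _ "i - 1"]) simp
      qed
    qed (use u(2) in \<open>auto simp: f_def lozenge_iffs\<close>)
  qed (use fg in \<open>auto simp: f_def g_def inj_def lozenge_iffs axis_weight_def\<close>)
  ultimately show ?thesis by simp
qed

lemma forced_bot:
  assumes "even (Nb - W) \<noteq> el" "1 \<le> Nb"
  shows "M (half eu el, axis_weight) = M (half eu el - {t. strip t = - Nb}, axis_weight)"
    and "1 \<le> N \<Longrightarrow> M (half eu el - {t. strip t = N - 1}, axis_weight)
       = M (half eu el - {t. strip t = N - 1} - {t. strip t = - Nb}, axis_weight)"
proof -
  \<comment> \<open>The bottom strip lies below the level -z of the east vertex, so it narrows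
    downwards just as the top strip narrows upwards.\<close>
  have zNb: "z < Nb" using z_Nb assms(2) by auto
  define p0 :: int where "p0 = (if el then - 1 else 0)"
  define n where "n = nat ((W + 2 * z - Nb - p0) div 2)"
  define f g where "f i = Up (p0 + 2 * int i) (- Nb)" and "g i = Down (p0 + 2 * int i + 1) (- Nb + 1)" for i
  have par: "even (p0 + Nb - W)" "even (W + 2 * z - Nb - p0)" using assms(1) by (auto simp: p0_def)
  have n: "i < n \<longleftrightarrow> p0 + 2 * int i + 2 \<le> W + 2 * z - Nb" for i
    using par(2) unfolding n_def by (auto elim!: evenE)
  have p0: "p0 \<ge> - 1" by (simp add: p0_def)
  have F: "t \<notin> F" if "strip t = - Nb" for t using F_bot[of t] that assms(2) by auto
  have fg: "f i \<in> half eu el" "g i \<in> half eu el" if "i < n" for i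
  proof -
    have "Up (p0 + 2 * int i) (- Nb) \<in> hex" "Down (p0 + 2 * int i + 1) (- Nb + 1) \<in> hex"
      using that p0 par zNb z0 a1_N assms(2) unfolding n by (auto simp: Up_hex Down_hex)
    moreover have "Up (p0 + 2 * int i) (- Nb) \<notin> center" "Down (p0 + 2 * int i + 1) (- Nb + 1) \<notin> center"
      using assms(2) by (auto simp: Down_center Up_center)
    ultimately show "f i \<in> half eu el" "g i \<in> half eu el"
      using F assms(2) by (auto simp: mem_half_iff f_def g_def p0_def)
  qed
  have row: "\<exists>i. t = f i \<and> i < n \<or> t = g i \<and> i < n" if t: "t \<in> half eu el" "strip t = - Nb" for t
  proof (cases t)
    case (Up q k)
    then have k: "k = - Nb" and h: "t \<in> hex" "0 \<le> q \<or> q = -1 \<and> el" using t assms(2) by (auto simp: mem_half_iff split: if_splits)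
    then have q: "even (q - k - W)" "q + 2 - (k + z) \<le> W + z"
      using Up_hex[of q k] Up zNb by auto
    have q1: "p0 \<le> q" "even (q - p0)" using q(1) h(2) par assms(1) k by (cases "q = 0"; auto simp: p0_def)+
    obtain j where j: "q - p0 = 2 * j" using q1(2) by (rule evenE)
    then have "t = f (nat j)" "nat j < n" using q(2) k q1 Up unfolding n by (auto simp: f_def)
    then show ?thesis by blast
  next
    case (Down q k)
    then have k: "k = - Nb + 1" and h: "t \<in> hex" "0 \<le> q \<or> q = -1 \<and> el" using t assms(2) by (auto simp: mem_half_iff split: if_splits)
    then have q: "even (q - k - W)" "q + 1 - (k - 1 + z) \<le> W + z"
      using Down_hex[of q k] Down zNb by auto
    have q1: "p0 + 1 \<le> q" "even (q - p0 - 1)" using q(1) h(2) par assms(1) k by (cases "q = 0"; auto simp: p0_def)+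
    obtain j where j: "q - p0 - 1 = 2 * j" using q1(2) by (rule evenE)
    then have "t = g (nat j)" "nat j < n" using q(2) k q1 Down unfolding n by (auto simp: g_def)
    then show ?thesis by blast
  qed
  \<comment> \<open>The intermediate set \<open>Q\<close> allows the strip to be removed both from
    the half itself and after the top strip.\<close>
  have main: "M (Q, axis_weight) = M (Q - {t. strip t = - Nb}, axis_weight)"
    if Q: "Q \<subseteq> half eu el" "half eu el \<inter> {t. strip t = - Nb} \<subseteq> Q" for Q
  proof -
    have fgQ: "f i \<in> Q" "g i \<in> Q" if "i < n" for i
      using fg[OF that] Q(2) by (auto simp: f_def g_def)
    have "Q \<inter> {t. strip t = - Nb} = f ` {..<n} \<union> g ` {..<n}"
    proof (intro equalityI subsetI)
      fix t assume "t \<in> Q \<inter> {t. strip t = - Nb}"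
      then show "t \<in> f ` {..<n} \<union> g ` {..<n}" using row[of t] Q(1) by blast
    qed (use fgQ in \<open>auto simp: f_def g_def\<close>)
    then have "Q - {t. strip t = - Nb} = Q - (f ` {..<n} \<union> g ` {..<n})" by blast
    moreover have "M (Q, axis_weight) = M (Q - (f ` {..<n} \<union> g ` {..<n}), axis_weight)"
    proof (rule M_forced_pairs)
      show "finite Q" using Q(1) finite_half finite_subset by blast
      fix i u assume i: "i < n" and "u \<in> Q" and u2: "is_lozenge {f i, u}"
      then have u: "u \<in> half eu el" "is_lozenge {f i, u}" using Q by auto
      show "\<exists>j\<le>i. u = g j"
      proof (cases u)
        case (Down q k)
        have "k \<noteq> - Nb" using u(1) Down Down_hex[of q k] by (auto simp: mem_half_iff)
        then have k: "k = - Nb + 1" and q: "q = p0 + 2 * int i + 1 \<or> q = p0 + 2 * int i - 1"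
          using u(2) Down by (auto simp: f_def lozenge_iffs)
        have "q \<noteq> p0 - 1" using u(1) Down assms(2) k by (auto simp: mem_half_iff p0_def split: if_splits)
        then consider "u = g i" | "i > 0" "u = g (i - 1)" using q Down k by (cases "i = 0") (auto simp: g_def of_nat_diff)
        then show ?thesis
      proof cases
        case 1
        then show ?thesis by (intro exI[of _ i]) simp
      next
        case 2
        then show ?thesis by (intro exI[of _ "i - 1"]) simp
      qed
      qed (use u(2) in \<open>auto simp: f_def lozenge_iffs\<close>)
    qed (use fgQ in \<open>auto simp: f_def g_def inj_def lozenge_iffs axis_weight_def\<close>)
    ultimately show ?thesis by simp
  qed
  show "M (half eu el, axis_weight) = M (half eu el - {t. strip t = - Nb}, axis_weight)"
    by (rule main) auto
  show "M (half eu el - {t. strip t = N - 1}, axis_weight)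
       = M (half eu el - {t. strip t = N - 1} - {t. strip t = - Nb}, axis_weight)" if "1 \<le> N"
    by (rule main) (use assms(2) that in auto)
qed

section \<open>Comparison with the halved regions\<close>

definition trimmed :: "bool \<Rightarrow> bool \<Rightarrow> triangle set" where
  "trimmed eu el = {t \<in> half eu el. if strip t \<ge> 0 then strip t < top_level eu else - bot_level el \<le> strip t}"

lemma strip_bounds: "t \<in> half eu el \<Longrightarrow> - Nb \<le> strip t \<and> strip t < N"
  by (cases t) (auto simp: mem_half_iff hex_def in_faces_in)

lemma M_trimmed: "M (half eu el, axis_weight) = M (trimmed eu el, axis_weight)"
proof -
  have bnd: "- Nb \<le> strip t \<and> strip t < N" if "t \<in> half eu el" for t using strip_bounds[OF that] .
  \<comment> \<open>A part of height 0 has no strip to remove, even if its level becomes -1, the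
    value for an empty part.\<close>
  define tp where "tp \<longleftrightarrow> even (N - W) \<noteq> eu \<and> 1 \<le> N"
  define bt where "bt \<longleftrightarrow> even (Nb - W) \<noteq> el \<and> 1 \<le> Nb"
  have N0: "0 \<le> N" using a1_N by simp
  have "trimmed eu el = half eu el - (if tp then {t. strip t = N - 1} else {}) - (if bt then {t. strip t = - Nb} else {})"
    using bnd N0 Nb0 by (fastforce simp: trimmed_def top_level_def bot_level_def tp_def bt_def split: if_splits)
  then show ?thesis
    using forced_top[of eu el] forced_bot[of el eu] by (auto simp: tp_def bt_def split: if_splits)
qed

text \<open>\<open>upper\<close>, \<open>cut\<close> and \<open>lower\<close> are the pieces of
  \<open>halved_region\<close> before the translation.\<close>

definition upper :: "bool \<Rightarrow> triangle set" where
  "upper eu = faces_in (lattice W \<inter>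
     {(p, k). 0 \<le> k \<and> k \<le> top_level eu \<and> zz eu W k \<le> p \<and> p \<le> W - k})"

definition cut :: "triangle set" where
  "cut = faces_in {(p, k). 0 \<le> k \<and> p \<le> int a1 - k}"

definition lower :: "bool \<Rightarrow> triangle set" where
  "lower el = faces_in (lattice W \<inter>
     {(p, k). - bot_level el \<le> k \<and> k \<le> 0 \<and> zz el W k \<le> p \<and> p \<le> min (W - k) (W + 2 * z + k)})"

lemma Up_upper: "Up p k \<in> upper eu \<longleftrightarrow>
  even (p - k - W) \<and> 0 \<le> k \<and> k < top_level eu \<and> (0 \<le> p \<or> p = - 1 \<and> eu) \<and> p + 2 \<le> W - k"
  using zz_Up[of p k W eu] by (auto simp: upper_def in_faces_in lattice_def)

lemma Down_upper: "Down p k \<in> upper eu \<longleftrightarrow>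
  even (p - k - W) \<and> 1 \<le> k \<and> k \<le> top_level eu \<and> (0 \<le> p \<or> p = - 1 \<and> eu) \<and> p + 2 \<le> W - k"
  using zz_Down[of p k W eu] by (auto simp: upper_def in_faces_in lattice_def)

lemma Up_lower: "Up p k \<in> lower el \<longleftrightarrow>
  even (p - k - W) \<and> - bot_level el \<le> k \<and> k < 0 \<and> (0 \<le> p \<or> p = - 1 \<and> el)
  \<and> p + 2 \<le> W - k \<and> p + 2 \<le> W + 2 * z + k"
  using zz_Up[of p k W el] by (auto simp: lower_def in_faces_in lattice_def)

lemma Down_lower: "Down p k \<in> lower el \<longleftrightarrow>
  even (p - k - W) \<and> - bot_level el < k \<and> k \<le> 0 \<and> (0 \<le> p \<or> p = - 1 \<and> el)
  \<and> p + 2 \<le> W - k \<and> p + 2 \<le> W + 2 * z + k"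
  using zz_Down[of p k W el] by (auto simp: lower_def in_faces_in lattice_def)

lemma Up_cut: "Up p k \<in> cut \<longleftrightarrow> 0 \<le> k \<and> p + 2 \<le> int a1 - k"
  by (auto simp: cut_def in_faces_in)

lemma Down_cut: "Down p k \<in> cut \<longleftrightarrow> 1 \<le> k \<and> p + 2 \<le> int a1 - k"
  by (auto simp: cut_def in_faces_in)

lemma levels: "top_level eu \<le> N" "bot_level el \<le> Nb"
  by (auto simp: top_level_def bot_level_def)

text \<open>The absolute values in the hexagon resolve differently above and below the line k = 0.
  \<open>cut\<close> can omit the west side of the central triangle: for \<open>p \<ge> - 1\<close>
  that bound follows from the one on the east side.\<close>

lemma trimmed_eq: "trimmed eu el = (upper eu - cut) \<union> lower el - F"
proof (rule set_eqI)
  fix t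
  show "t \<in> trimmed eu el \<longleftrightarrow> t \<in> (upper eu - cut) \<union> lower el - F"
  proof (cases t)
    case (Up p k)
    show ?thesis
    proof (cases "p \<ge> - 1")
      case True
      have T: "t \<in> trimmed eu el \<longleftrightarrow> t \<notin> F \<and> even (p - k - W) \<and> - Nb \<le> k \<and> k < N
        \<and> p + 2 + \<bar>k + z\<bar> \<le> W + z \<and> p + 1 + \<bar>k + 1 + z\<bar> \<le> W + z
        \<and> \<not> (0 \<le> k \<and> - int a1 + k \<le> p \<and> p + 2 \<le> int a1 - k)
        \<and> (0 \<le> p \<or> p = - 1 \<and> (if k \<ge> 0 then eu else el))
        \<and> (if k \<ge> 0 then k < top_level eu else - bot_level el \<le> k)"
        unfolding Up trimmed_def mem_Collect_eq mem_half_iff Up_hex[OF True] Up_center by auto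
      show ?thesis
      proof (cases "0 \<le> k")
        case True
        then show ?thesis unfolding T using Up Nb0 z0 levels(1)[of eu]
          by (auto simp: Up_upper Up_lower Up_cut)
      next
        case False
        then show ?thesis unfolding T using Up a1_N levels(2)[of el]
          by (auto simp: Up_upper Up_lower Up_cut)
      qed
    next
      case False
      then show ?thesis using Up by (auto simp: Up_upper Up_lower trimmed_def mem_half_iff)
    qed
  next
    case (Down p k)
    show ?thesis
    proof (cases "p \<ge> - 1")
      case True
      have T: "t \<in> trimmed eu el \<longleftrightarrow> t \<notin> F \<and> even (p - k - W) \<and> - Nb < k \<and> k \<le> N
        \<and> p + 2 + \<bar>k + z\<bar> \<le> W + z \<and> p + 1 + \<bar>k - 1 + z\<bar> \<le> W + z
        \<and> \<not> (1 \<le> k \<and> - int a1 + k \<le> p \<and> p + 2 \<le> int a1 - k)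
        \<and> (0 \<le> p \<or> p = - 1 \<and> (if k \<ge> 1 then eu else el))
        \<and> (if k \<ge> 1 then k \<le> top_level eu else - bot_level el < k)"
        unfolding Down trimmed_def mem_Collect_eq mem_half_iff Down_hex[OF True] Down_center by auto
      show ?thesis
      proof (cases "1 \<le> k")
        case True
        then show ?thesis unfolding T using Down Nb0 z0 levels(1)[of eu]
          by (auto simp: Down_upper Down_lower Down_cut)
      next
        case False
        then show ?thesis unfolding T using Down a1_N levels(2)[of el]
          by (auto simp: Down_upper Down_lower Down_cut)
      qed
    next
      case False
      then show ?thesis using Down by (auto simp: Down_upper Down_lower trimmed_def mem_half_iff)
    qed
  qed
qed

text \<open>A zigzag carries weights only where the axis triangles are kept; otherwise no lozenge
  lies on the axis there.\<close>

definition axis_zigzag :: "bool \<Rightarrow> bool \<Rightarrow> (int \<Rightarrow> int) \<Rightarrow> (int \<Rightarrow> int) \<Rightarrow> point set set" where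
  "axis_zigzag eu el \<alpha> \<beta> =
     (if eu then upper_zigzag (top_level eu) \<alpha> else {}) \<union> (if el then lower_zigzag (bot_level el) \<beta> else {})"

text \<open>A zigzag that includes the axis triangles turns west at the west corner of every
  vertical lozenge on the axis, and nowhere else. So these are the lozenges with both western sides
  on it.\<close>

lemma zigzag_weight_trimmed:
  assumes \<alpha>: "\<And>k. \<alpha> k = zz eu W k + d" and \<beta>: "\<And>k. \<beta> k = zz el W k + d"
    and l: "l \<subseteq> trimmed eu el" "is_lozenge l"
  shows "zigzag_weight (axis_zigzag eu el \<alpha> \<beta>) (tau d ` l) = axis_weight l"
proof -
  let ?Z = "axis_zigzag eu el \<alpha> \<beta>"
  let ?P = "\<lambda>p k. tau d ` l = {Up p k, Down p k} \<and>
               {(p, k), (p + 1, k + 1)} \<in> ?Z \<and> {(p, k), (p + 1, k - 1)} \<in> ?Z"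
  have "l \<subseteq> {t. cx t = 0} \<longleftrightarrow> (\<exists>p k. ?P p k)"
  proof
    assume ax: "l \<subseteq> {t. cx t = 0}"
    obtain s t where st: "l = {s, t}" "s \<noteq> t" using lozenge_obtain[OF l(2)] by metis
    have "\<exists>k. l = {Up (- 1) k, Down (- 1) k}"
      using ax st l(2) by (cases s; cases t) (auto simp: lozenge_iffs)
    then obtain k where k: "l = {Up (- 1) k, Down (- 1) k}" by blast
    then have in_trimmed: "Up (- 1) k \<in> trimmed eu el" "Down (- 1) k \<in> trimmed eu el" using l(1) by auto
    then have "Up (- 1) k \<notin> center" by (simp add: trimmed_def mem_half_iff)
    with in_trimmed have U: "Up (- 1) k \<in> upper eu \<union> lower el" "Up (- 1) k \<notin> center"
      "Down (- 1) k \<in> upper eu \<union> lower el"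
      unfolding trimmed_eq by blast+
    have odd: "odd (k - W)" using U(1) by (auto simp: Up_upper Up_lower)
    \<comment> \<open>A lozenge on the axis across the line k = 0 would have its western sides on
      different zigzags. It cannot occur, since its upper half would lie in the removed central
      triangle.\<close>
    have k0: "k \<noteq> 0"
    proof
      assume "k = 0"
      then have "odd a1" using odd W_a1 by auto
      then have "0 < a1" by (rule odd_pos)
      then show False using U(2) \<open>k = 0\<close> by (simp add: Up_center)
    qed
    have v: "\<alpha> k = (if eu then d - 1 else d + 1)" "\<alpha> (k + 1) = d" "\<alpha> (k - 1) = d"
        "\<beta> (- k) = (if el then d - 1 else d + 1)" "\<beta> (- k + 1) = d" "\<beta> (- k - 1) = d"
      using odd by (auto simp: \<alpha> \<beta> zz_def)
    have "{(d - 1, k), (d, k + 1)} \<in> ?Z \<and> {(d - 1, k), (d, k - 1)} \<in> ?Z"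
    proof (cases "k > 0")
      case True
      then have "eu" "k < top_level eu" using U by (auto simp: Up_upper Up_lower)
      moreover have "{(\<alpha> k, k), (\<alpha> (k + 1), k + 1)} \<in> upper_zigzag (top_level eu) \<alpha>"
        "{(\<alpha> (k - 1), k - 1), (\<alpha> (k - 1 + 1), k - 1 + 1)} \<in> upper_zigzag (top_level eu) \<alpha>"
        unfolding upper_zigzag_def using True calculation by force+
      ultimately show ?thesis using v by (simp add: axis_zigzag_def insert_commute)
    next
      case False
      then have neg: "k < 0" using k0 by simp
      then have "el" "- bot_level el < k" using U by (auto simp: Down_upper Down_lower Up_upper Up_lower)
      moreover have "{(\<beta> (- k), - (- k)), (\<beta> (- k + 1), - (- k + 1))} \<in> lower_zigzag (bot_level el) \<beta>"
        "{(\<beta> (- k - 1), - (- k - 1)), (\<beta> (- k - 1 + 1), - (- k - 1 + 1))} \<in> lower_zigzag (bot_level el) \<beta>"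
        unfolding lower_zigzag_def using neg calculation by force+
      ultimately show ?thesis using v by (simp add: axis_zigzag_def insert_commute add.commute)
    qed
    then have "?P (d - 1) k" using k by simp
    then show "\<exists>p k. ?P p k" by blast
  next
    assume "\<exists>p k. ?P p k"
    then obtain p k where p: "tau d ` l = {Up p k, Down p k}" and e: "{(p, k), (p + 1, k + 1)} \<in> ?Z" by blast
    \<comment> \<open>A zigzag edge that rises eastwards starts at a western turning point, where
      \<open>zz\<close> has the value -1.\<close>
    have "p = d - 1"
    proof -
      consider "eu" "{(p, k), (p + 1, k + 1)} \<in> upper_zigzag (top_level eu) \<alpha>"
        | "el" "{(p, k), (p + 1, k + 1)} \<in> lower_zigzag (bot_level el) \<beta>"
        using e by (auto simp: axis_zigzag_def split: if_splits)
      then show ?thesis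
      proof cases
        case 1
        then obtain j where "{(p, k), (p + 1, k + 1)} = {(\<alpha> j, j), (\<alpha> (j + 1), j + 1)}" by (auto simp: upper_zigzag_def)
        then have "p = \<alpha> j" "p + 1 = \<alpha> (j + 1)" by (auto simp: doubleton_eq_iff)
        then show ?thesis using 1 by (auto simp: \<alpha> zz_def split: if_splits)
      next
        case 2
        then obtain j where "{(p, k), (p + 1, k + 1)} = {(\<beta> j, - j), (\<beta> (j + 1), - (j + 1))}" by (auto simp: lower_zigzag_def)
        then have "p = \<beta> (j + 1)" "p + 1 = \<beta> j" by (auto simp: doubleton_eq_iff)
        then show ?thesis using 2 by (auto simp: \<beta> zz_def split: if_splits)
      qed
    qed
    moreover have cx_tau: "cx (tau d t) = cx t + d" for t by (cases t) auto
    moreover have "cx (tau d t) = p + 1" if "t \<in> l" for t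
    proof -
      have "tau d t \<in> {Up p k, Down p k}" using that p by blast
      then show ?thesis by (elim insertE) auto
    qed
    ultimately show "l \<subseteq> {t. cx t = 0}" by fastforce
  qed
  then show ?thesis by (simp add: zigzag_weight_def axis_weight_def)
qed

lemma tau_lattice: "even (W + d) \<Longrightarrow> (p + d, k) \<in> lattice 0 \<longleftrightarrow> (p, k) \<in> lattice W"
  by (auto simp: lattice_def)

text \<open>\<open>d\<close> is the doubled horizontal position of the axis in the coordinates of
  the halved region: 0 if the side \<open>a1\<close> is even, and 1 for \<open>N4\<close> and -1 for
  \<open>N1\<close>, where half of \<open>a1\<close> is rounded up or down.\<close>

lemma M_half:
  assumes L: "2 * halved_L x' y' a' b = W + d"
    and a: "2 * int (entry a' 1) = int a1 + d"
    and z': "int z' = z"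
    and \<alpha>: "\<And>k. \<alpha> k = zz eu W k + d" and \<beta>: "\<And>k. \<beta> k = zz el W k + d"
    and F: "tau d ` F = (\<Union>i\<in>{2..length a'}. fern_triangle i (2 * psum a' (i - 1)) (entry a' i))
           \<union> (\<Union>j\<in>{1..length b}. fern_triangle j (2 * halved_L x' y' a' b - 2 * psum b j) (entry b j))"
  shows "M (half eu el, axis_weight) =
    M (halved_region x' y' z' a' b (top_level eu) \<alpha> (bot_level el) \<beta>, zigzag_weight (axis_zigzag eu el \<alpha> \<beta>))"
proof -
  have Wd: "even (W + d)" using L by (metis dvd_triv_left)
  have "halved_region x' y' z' a' b (top_level eu) \<alpha> (bot_level el) \<beta> = tau d ` trimmed eu el"
  proof (rule tau_image_eqI[symmetric])
    fix t
    have U: "{(p, k). (p + d, k) \<in> lattice 0 \<inter> {(p, k). 0 \<le> k \<and> k \<le> top_level eu \<and> \<alpha> k \<le> p \<and> p \<le> 2 * halved_L x' y' a' b - k}}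
      = lattice W \<inter> {(p, k). 0 \<le> k \<and> k \<le> top_level eu \<and> zz eu W k \<le> p \<and> p \<le> W - k}"
      using tau_lattice[OF Wd] by (auto simp: L \<alpha>)
    have C: "{(p, k). (p + d, k) \<in> {(p, k). 0 \<le> k \<and> p \<le> 2 * int (entry a' 1) - k}} = {(p, k). 0 \<le> k \<and> p \<le> int a1 - k}"
      unfolding a by auto
    have Lo: "{(p, k). (p + d, k) \<in> lattice 0 \<inter>
       {(p, k). - bot_level el \<le> k \<and> k \<le> 0 \<and> \<beta> (- k) \<le> p \<and> p \<le> min (2 * halved_L x' y' a' b - k) (2 * halved_L x' y' a' b + 2 * int z' + k)}}
      = lattice W \<inter> {(p, k). - bot_level el \<le> k \<and> k \<le> 0 \<and> zz el W k \<le> p \<and> p \<le> min (W - k) (W + 2 * z + k)}"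
    proof -
      have "zz el W (- k) = zz el W k" for k by (simp add: zz_def)
      then show ?thesis using tau_lattice[OF Wd] by (auto simp: L \<beta> z')
    qed
    have F': "tau d t \<in> tau d ` F \<longleftrightarrow> t \<in> F" by (simp add: inj_image_mem_iff[OF inj_tau])
    show "tau d t \<in> halved_region x' y' z' a' b (top_level eu) \<alpha> (bot_level el) \<beta> \<longleftrightarrow> t \<in> trimmed eu el"
      unfolding halved_region_def Let_def F[symmetric] Diff_iff Un_iff F' tau_in_faces_in U C Lo
      by (simp add: trimmed_eq upper_def cut_def lower_def)
  qed
  then have "M (halved_region x' y' z' a' b (top_level eu) \<alpha> (bot_level el) \<beta>, zigzag_weight (axis_zigzag eu el \<alpha> \<beta>))
    = M (trimmed eu el, \<lambda>l. zigzag_weight (axis_zigzag eu el \<alpha> \<beta>) (tau d ` l))"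
    using M_image[OF inj_tau lozenge_tau] by simp
  also have "\<dots> = M (trimmed eu el, axis_weight)"
    by (rule M_cong) (use zigzag_weight_trimmed[OF \<alpha> \<beta>] in blast)
  finally show ?thesis using M_trimmed by simp
qed

section \<open>Triangles on the axis and their ranks\<close>

definition axis_triangle :: "int \<Rightarrow> triangle" where
  "axis_triangle s = (if even (s - W) then Down (- 1) (s + 1) else Up (- 1) s)"

definition axis_strips :: "int set" where "axis_strips = {- Nb..<N} - {0..<int a1}"

lemma strip_axis_triangle [simp]: "strip (axis_triangle s) = s"
  by (simp add: axis_triangle_def)

lemma cx_axis_triangle [simp]: "cx (axis_triangle s) = 0"
  by (simp add: axis_triangle_def)

lemma hex_lattice: "hex \<subseteq> faces_in (lattice W)"
  by (auto simp: hex_def faces_in_def)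

text \<open>Each strip has exactly one lattice triangle centred on the axis, and its orientation
  follows from parity.\<close>

lemma axis_triangle_eq: "t \<in> hex \<Longrightarrow> cx t = 0 \<Longrightarrow> t = axis_triangle (strip t)"
  using hex_lattice by (cases t) (auto simp: axis_triangle_def in_faces_in lattice_def subset_iff)

lemma axis_triangle_in_hex: "axis_triangle s \<in> hex \<longleftrightarrow> - Nb \<le> s \<and> s < N"
proof (cases "even (s - W)")
  case True
  \<comment> \<open>The top strip could lose its axis triangle only if the north side had length 0;
    but then parity makes that triangle up-pointing, and it fits.\<close>
  have "s + 2 \<le> W" if "s < N"
  proof -
    have "s + 1 \<noteq> W" using True by auto
    then show ?thesis using that N_W by linarith
  qed
  then show ?thesis using True z0 Nb_W N_W by (auto simp: axis_triangle_def Down_hex)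
next
  case False
  have "s \<noteq> - W - 2 * z" using False by auto
  then show ?thesis using False z0 Nb_W N_W by (auto simp: axis_triangle_def Up_hex)
qed

lemma axis_triangle_in_center: "axis_triangle s \<in> center \<longleftrightarrow> 0 \<le> s \<and> s < int a1"
proof (cases "even (s - W)")
  case True
  have "s \<noteq> int a1 - 1" using True W_a1 by auto
  then show ?thesis using True by (auto simp: axis_triangle_def Down_center)
next
  case False
  then show ?thesis by (auto simp: axis_triangle_def Up_center)
qed

lemma axis_Reg: "{t \<in> Reg. cx t = 0} = axis_triangle ` axis_strips"
proof (intro equalityI subsetI)
  fix t assume "t \<in> {t \<in> Reg. cx t = 0}"
  then have t: "t \<in> hex" "t \<notin> center" "cx t = 0" by (auto simp: Reg_def)
  then show "t \<in> axis_triangle ` axis_strips"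
    using axis_triangle_eq[OF t(1,3)] axis_triangle_in_hex[of "strip t"] axis_triangle_in_center[of "strip t"]
    by (intro image_eqI[of _ _ "strip t"]) (auto simp: axis_strips_def)
next
  fix t assume "t \<in> axis_triangle ` axis_strips"
  then obtain s where s: "s \<in> axis_strips" "t = axis_triangle s" by blast
  then have "t \<in> hex" "t \<notin> center" "cx t = 0"
    by (auto simp: axis_triangle_in_hex axis_triangle_in_center axis_strips_def)
  then show "t \<in> {t \<in> Reg. cx t = 0}"
    using F_right[of t] not_mirror_F[of t] by (auto simp: Reg_def)
qed

lemma inj_axis_triangle: "inj axis_triangle"
  by (metis injI strip_axis_triangle)

lemma Reg_lattice: "Reg \<subseteq> faces_in (lattice W)"
  using hex_lattice by (auto simp: Reg_def)

lemma Reg_mirror: "t \<in> Reg \<Longrightarrow> mirror t \<in> Reg"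
proof -
  have "mirror t \<in> hex" if "t \<in> hex" for t
    using that by (cases t) (auto simp: hex_def in_faces_in lattice_def)
  moreover have "t \<in> center" if "mirror t \<in> center" for t
    using that by (cases t) (auto simp: Up_center Down_center)
  moreover have "mirror t \<in> F \<longleftrightarrow> t \<in> mirror ` F" "mirror t \<in> mirror ` F \<longleftrightarrow> t \<in> F" for t
    by (metis image_iff mirror_mirror)+
  ultimately show "mirror t \<in> Reg" if "t \<in> Reg" using that by (auto simp: Reg_def)
qed

sublocale mirror_region Reg W
  by unfold_locales (use finite_Reg Reg_lattice Reg_mirror in auto)

lemma Ax_eq: "Ax = axis_triangle ` axis_strips"
  by (simp add: Ax_def axis_Reg)

lemma card_Ax: "int (card Ax) = N + Nb - int a1"
proof -
  have "card Ax = card axis_strips"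
    unfolding Ax_eq by (rule card_image) (rule inj_on_subset[OF inj_axis_triangle], simp)
  also have "int (card axis_strips) = N + Nb - int a1"
    unfolding axis_strips_def using a1_N Nb0 by (subst card_Diff_subset) auto
  finally show ?thesis .
qed

text \<open>The axis strips are consecutive except for the gap at the central triangle, which shifts
  the ranks above it by \<open>a1\<close>.\<close>

lemma rk_eq:
  assumes "v \<in> Ax"
  shows "int (rk v) = (if strip v < 0 then strip v + Nb else strip v + Nb - int a1)"
proof -
  obtain s where s: "s \<in> axis_strips" "v = axis_triangle s" using assms by (auto simp: Ax_eq)
  have "{u \<in> Ax. strip u < strip v} = axis_triangle ` {r \<in> axis_strips. r < s}"
    using s by (auto simp: Ax_eq)
  then have "rk v = card {r \<in> axis_strips. r < s}"
    unfolding rk_def by (simp add: card_image inj_on_subset[OF inj_axis_triangle])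
  also have "{r \<in> axis_strips. r < s} = (if s < 0 then {- Nb..<s} else {- Nb..<s} - {0..<int a1})"
    using s(1) by (auto simp: axis_strips_def)
  also have "int (card \<dots>) = (if s < 0 then s + Nb else s + Nb - int a1)"
    using s(1) Nb0 by (auto simp: axis_strips_def card_Diff_subset)
  finally show ?thesis by (simp add: s(2))
qed

text \<open>With offset \<open>Nb\<close> and an even gap, rank plus strip plus offset is even
  everywhere: \<open>K\<close> is the whole axis.\<close>

lemma M_Reg_even:
  assumes "even a1" "2 * int n = N + Nb - int a1"
  shows "M (Reg, \<lambda>l. 1) = 2 ^ n * M (half True True, axis_weight) * M (half False False, axis_weight)"
proof -
  have "card Ax = 2 * n" using card_Ax assms(2) by linarith
  moreover have "v \<in> Ax \<longleftrightarrow> even (int (rk v) + strip v + Nb)" if "v \<in> Ax" for v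
    using that assms(1) by (auto simp: rk_eq)
  moreover have "{t \<in> Reg. 0 < cx t} \<union> Ax = half True True" "{t \<in> Reg. 0 < cx t} \<union> (Ax - Ax) = half False False"
    by (auto simp: half_def Ax_def)
  ultimately show ?thesis using factorization[of Ax Nb n] by simp
qed

text \<open>An odd gap changes the parity at the central triangle; the offset \<open>Nb + 1\<close>
  makes \<open>K\<close> the part of the axis above it.\<close>

lemma M_Reg_odd:
  assumes "odd a1" "2 * int n = N + Nb - int a1"
  shows "M (Reg, \<lambda>l. 1) = 2 ^ n * M (half True False, axis_weight) * M (half False True, axis_weight)"
proof -
  let ?K = "{t \<in> Ax. 0 \<le> strip t}"
  have "card Ax = 2 * n" using card_Ax assms(2) by linarith
  moreover have "v \<in> ?K \<longleftrightarrow> even (int (rk v) + strip v + (Nb + 1))" if "v \<in> Ax" for v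
    using that assms(1) by (auto simp: rk_eq)
  moreover have "{t \<in> Reg. 0 < cx t} \<union> ?K = half True False" "{t \<in> Reg. 0 < cx t} \<union> (Ax - ?K) = half False True"
    by (auto simp: half_def Ax_def)
  ultimately show ?thesis using factorization[of ?K "Nb + 1" n] by simp
qed

end

section \<open>Ferns\<close>

lemma entry_Cons: "entry (c # xs) 1 = c" "1 \<le> i \<Longrightarrow> entry (c # xs) (Suc i) = entry xs i"
  by (auto simp: entry_def)

lemma odd_sum_Cons: "odd_sum (c # xs) = c + even_sum xs"
proof -
  have "{i. i \<in> {1..length (c # xs)} \<and> odd i} = insert 1 (Suc ` {i. i \<in> {1..length xs} \<and> even i})"
    by (auto simp: image_iff elim!: oddE)
  then have "odd_sum (c # xs) = sum (entry (c # xs)) (insert 1 (Suc ` {i. i \<in> {1..length xs} \<and> even i}))"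
    by (simp only: odd_sum_def)
  also have "\<dots> = c + (\<Sum>i | i \<in> {1..length xs} \<and> even i. entry (c # xs) (Suc i))"
    by (subst sum.insert) (auto simp: sum.reindex entry_Cons[simplified])
  finally show ?thesis by (simp add: even_sum_def entry_Cons)
qed

lemma even_sum_Cons: "even_sum (c # xs) = odd_sum xs"
proof -
  have "{i. i \<in> {1..length (c # xs)} \<and> even i} = Suc ` {i. i \<in> {1..length xs} \<and> odd i}"
    by (auto simp: image_iff elim!: evenE) presburger+
  then show ?thesis
    unfolding odd_sum_def even_sum_def by (simp add: sum.reindex entry_Cons)
qed

lemma sums_Nil: "odd_sum [] = 0" "even_sum [] = 0" "entry [] i = 0"
  by (simp_all add: odd_sum_def even_sum_def entry_def)

lemma sum_list_odd_even: "sum_list a = odd_sum a + even_sum a"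
proof (induction a)
  case Nil then show ?case by (simp add: sums_Nil)
next
  case (Cons c a) then show ?case by (simp add: odd_sum_Cons even_sum_Cons)
qed

lemma entry_le_odd_sum: "odd i \<Longrightarrow> entry a i \<le> odd_sum a"
  unfolding odd_sum_def by (cases "i \<in> {1..length a}") (auto intro!: member_le_sum simp: entry_def)

lemma entry_le_even_sum: "even i \<Longrightarrow> entry a i \<le> even_sum a"
  unfolding even_sum_def by (cases "i \<in> {1..length a}") (auto intro!: member_le_sum simp: entry_def)

lemma fern_triangle_bounds:
  assumes "t \<in> fern_triangle i p s"
  shows "p < cx t" "odd i \<Longrightarrow> 0 \<le> strip t \<and> strip t < int s" "even i \<Longrightarrow> - int s \<le> strip t \<and> strip t < 0"
  using assms by (cases t; auto simp: fern_triangle_def in_faces_in split: if_splits)+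

lemma psum_le: "psum b j \<le> int (sum_list b)"
proof -
  have "sum_list b = sum_list (take j b) + sum_list (drop j b)"
    by (metis append_take_drop_id sum_list_append)
  then show ?thesis by (simp add: psum_def)
qed

lemma psum_Cons: "1 \<le> i \<Longrightarrow> psum (c # xs) i = int c + psum xs (i - 1)"
  by (cases i) (auto simp: psum_def)

lemma psum_nonneg: "0 \<le> psum a i"
  by (simp add: psum_def)

section \<open>The parameters of the symmetric hexagon\<close>

locale symmetric_hexagon =
  fixes x y z :: nat and a b :: "nat list"
  assumes parity: "x mod 2 = y mod 2"
begin

definition "Wd = int x + int y + 2 * int (sum_list a) - int (entry a 1) + 2 * int (sum_list b)"
text \<open>The distances of the horizontal sides from the line k = 0: \<open>ne - z\<close> here
  and \<open>se + z\<close> for \<open>south\<close>, as \<open>S1\<close> measures from the level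
  -z of the east and west vertices.\<close>

definition "north = int y + 2 * int (odd_sum a) - int (entry a 1) + 2 * int (odd_sum b)"
definition "south = int y + 2 * int z + 2 * int (even_sum a) + 2 * int (even_sum b)"
definition "ferns = (\<Union>i\<in>{2..length a}. fern_triangle i (2 * psum a (i - 1) - int (entry a 1)) (entry a i))
           \<union> (\<Union>j\<in>{1..length b}. fern_triangle j (Wd - 2 * psum b j) (entry b j))"

lemma ferns_bounds:
  assumes "t \<in> ferns"
  shows "0 < cx t \<and> (0 \<le> strip t \<longrightarrow> strip t \<le> north - 2) \<and> (strip t < 0 \<longrightarrow> - south + 1 \<le> strip t)"
proof -
  have a1: "entry a 1 \<le> odd_sum a" by (rule entry_le_odd_sum) simp
  \<comment> \<open>The factor 2 keeps the removed triangles off the outermost strips: a nonempty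
    triangle has \<open>s \<ge> 1\<close>, so \<open>s\<close> is smaller than the height of its
    part.\<close>
  have *: "?thesis" if "t \<in> fern_triangle i p s" "0 \<le> p" "odd i \<Longrightarrow> 2 * int s \<le> north" "even i \<Longrightarrow> 2 * int s \<le> south" for i p s
    using fern_triangle_bounds[OF that(1)] that(2-) by (cases "odd i") auto
  consider i where "2 \<le> i" "i \<le> length a" "t \<in> fern_triangle i (2 * psum a (i - 1) - int (entry a 1)) (entry a i)"
    | j where "1 \<le> j" "t \<in> fern_triangle j (Wd - 2 * psum b j) (entry b j)"
    using assms unfolding ferns_def by auto
  then show ?thesis
  proof cases
    case (1 i)
    then obtain c xs where a: "a = c # xs" by (cases a) auto
    obtain k where k: "i = Suc k" "1 \<le> k" using 1 by (cases i) auto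
    show ?thesis
    proof (rule *[OF 1(3)])
      show "0 \<le> 2 * psum a (i - 1) - int (entry a 1)"
        using k psum_nonneg[of xs "k - 1"] by (simp add: a psum_Cons entry_Cons[simplified])
      show "2 * int (entry a i) \<le> north" if "odd i"
        using that k entry_le_even_sum[of k xs]
        unfolding north_def by (simp add: a odd_sum_Cons entry_Cons entry_Cons[simplified])
      show "2 * int (entry a i) \<le> south" if "even i"
        using that k entry_le_odd_sum[of k xs]
        unfolding south_def by (simp add: a even_sum_Cons entry_Cons)
    qed
  next
    case (2 j)
    show ?thesis
    proof (rule *[OF 2(2)])
      show "0 \<le> Wd - 2 * psum b j"
        using psum_le[of b j] a1 sum_list_odd_even[of a] by (simp add: Wd_def)
      show "2 * int (entry b j) \<le> north" if "odd j"
        using that a1 entry_le_odd_sum[of j b] by (simp add: north_def)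
      show "2 * int (entry b j) \<le> south" if "even j"
        using that entry_le_even_sum[of j b] by (simp add: south_def)
    qed
  qed
qed

sublocale half_setup Wd north south "int z" "entry a 1" ferns
proof
  have a1: "entry a 1 \<le> odd_sum a" by (rule entry_le_odd_sum) simp
  note sums = sum_list_odd_even[of a] sum_list_odd_even[of b]
  show "int (entry a 1) \<le> north" using a1 by (simp add: north_def)
  show "south = 0 \<or> int z < south" by (auto simp: south_def)
  show "0 \<le> south" by (simp add: south_def)
  show "north \<le> Wd" "south \<le> Wd + 2 * int z"
    using a1 sums by (simp_all add: north_def south_def Wd_def)
  have "even (int x + int y)" using parity by presburger
  then show "even (Wd - int (entry a 1))" by (simp add: Wd_def)
qed (use ferns_bounds in auto)

lemma S1_eq: "S1 x y z a b = (Reg, \<lambda>l. 1)"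
proof -
  have "- int z - (int y + int z + 2 * int (even_sum a) + 2 * int (even_sum b)) = - south"
    "- int z + (int y + int z + 2 * int (odd_sum a) - int (entry a 1) + 2 * int (odd_sum b)) = north"
    by (simp_all add: south_def north_def)
  then show ?thesis
    unfolding S1_def Let_def Reg_def hex_def center_def
    by (simp only: Wd_def[symmetric] ferns_def[symmetric])
qed

text \<open>Replacing the first entry by \<open>c\<close> moves the east end of the central base,
  measured from the new origin, to \<open>2 * int c\<close>; translation by \<open>d\<close> moves
  it there from \<open>a1\<close>, and all later triangles follow. For the empty sequence,
  \<open>c # tl a\<close> is a one-term sequence.\<close>

lemma M_half_halved:
  assumes c: "2 * int c = int (entry a 1) + d" and xy: "2 * int (x' + y') = int x + int y"
    and \<alpha>: "\<And>k. \<alpha> k = zz eu Wd k + d" and \<beta>: "\<And>k. \<beta> k = zz el Wd k + d"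
    and A: "A = top_level eu" and B: "B = bot_level el"
  shows "M (half eu el, axis_weight) = M (halved_region x' y' z (c # tl a) b A \<alpha> B \<beta>,
      zigzag_weight ((if eu then upper_zigzag A \<alpha> else {}) \<union> (if el then lower_zigzag B \<beta> else {})))"
proof -
  let ?a = "c # tl a"
  have L: "2 * halved_L x' y' ?a b = Wd + d"
    unfolding Wd_def halved_L_def using c xy by (cases a) (auto simp: entry_def)
  have "tau d ` ferns = (\<Union>i\<in>{2..length a}. fern_triangle i (2 * psum a (i - 1) - int (entry a 1) + d) (entry a i))
           \<union> (\<Union>j\<in>{1..length b}. fern_triangle j (Wd - 2 * psum b j + d) (entry b j))"
    unfolding ferns_def by (simp add: image_Un image_UN tau_fern_triangle)
  also have "(\<Union>i\<in>{2..length a}. fern_triangle i (2 * psum a (i - 1) - int (entry a 1) + d) (entry a i))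
     = (\<Union>i\<in>{2..length ?a}. fern_triangle i (2 * psum ?a (i - 1)) (entry ?a i))"
  proof (cases a)
    case (Cons c' xs)
    have "fern_triangle i (2 * psum a (i - 1) - int (entry a 1) + d) (entry a i)
      = fern_triangle i (2 * psum ?a (i - 1)) (entry ?a i)" if "2 \<le> i" for i
    proof -
      obtain k where k: "i = Suc k" "1 \<le> k" using \<open>2 \<le> i\<close> by (cases i) auto
      have "2 * psum a (i - 1) - int (entry a 1) + d = 2 * psum ?a (i - 1)"
        using k c by (simp add: Cons psum_Cons entry_Cons[simplified])
      moreover have "entry a i = entry ?a i" using k by (simp add: Cons entry_Cons)
      ultimately show ?thesis by simp
    qed
    moreover have "length a = length ?a" using Cons by simp
    ultimately show ?thesis by (intro SUP_cong) auto
  qed simp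
  also have "(\<Union>j\<in>{1..length b}. fern_triangle j (Wd - 2 * psum b j + d) (entry b j))
    = (\<Union>j\<in>{1..length b}. fern_triangle j (2 * halved_L x' y' ?a b - 2 * psum b j) (entry b j))"
    by (simp add: L algebra_simps)
  finally show ?thesis
    unfolding A B axis_zigzag_def[symmetric]
    by (intro M_half[OF L _ _ \<alpha> \<beta>]) (use c in \<open>simp_all add: entry_def\<close>)
qed

end

section \<open>The factors for even and for odd side of the central triangle\<close>

lemma zigzag_weight_empty: "zigzag_weight {} = (\<lambda>l. 1)"
  by (simp add: zigzag_weight_def fun_eq_iff)

theorem theorem2p20:
  fixes x y z :: nat and a b :: "nat list"
  assumes "x mod 2 = y mod 2"
  shows
    "(even (entry a 1) \<longrightarrow>
        M (S1 x y z a b) =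
          2 ^ (y + z + sum_list a + sum_list b - entry a 1)
          * M (H2 (x div 2) ((y + 1) div 2) z ((entry a 1 div 2) # tl a) b)
          * M (W1 ((x + 1) div 2) (y div 2) z ((entry a 1 div 2) # tl a) b))
     \<and>
     (odd (entry a 1) \<longrightarrow>
        M (S1 x y z a b) =
          2 ^ (y + z + sum_list a + sum_list b - entry a 1)
          * M (N4 (x div 2) ((y + 1) div 2) z (((entry a 1 + 1) div 2) # tl a) b)
          * M (N1 ((x + 1) div 2) (y div 2) z (((entry a 1 - 1) div 2) # tl a) b))"
proof -
  interpret symmetric_hexagon x y z a b by unfold_locales (rule assms)
  define a1 where "a1 = entry a 1"
  define n where "n = y + z + sum_list a + sum_list b - a1"
  have a1: "a1 \<le> odd_sum a" unfolding a1_def by (rule entry_le_odd_sum) simp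
  note sums = sum_list_odd_even[of a] sum_list_odd_even[of b]
  \<comment> \<open>The exponent is half the number of axis triangles;
    \<open>a1 \<le> odd_sum a\<close> makes the subtraction of natural numbers exact.\<close>
  have n: "2 * int n = north + south - int (entry a 1)"
    using a1 sums by (simp add: n_def north_def south_def a1_def)
  have o: "int (odd_sum (c # tl a)) = int (odd_sum a) - int a1 + int c"
    and e: "even_sum (c # tl a) = even_sum a" for c
    by (cases a; simp add: odd_sum_Cons even_sum_Cons sums_Nil a1_def entry_Cons[simplified])+
  \<comment> \<open>As x and y have the same parity, rounding one half up and the other down gives
    exactly half of x + y.\<close>
  have xy: "2 * int (x div 2 + (y + 1) div 2) = int x + int y" "2 * int ((x + 1) div 2 + y div 2) = int x + int y"
    using assms by presburger+
  have Wpar: "even (Wd - int a1)" using W_a1 by (simp add: a1_def)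
  have ypar: "even north \<longleftrightarrow> even (int y + int a1)" "even south \<longleftrightarrow> even (int y)"
    by (simp_all add: north_def south_def a1_def)
  \<comment> \<open>The rounding of y/2 has the same parity rule as the dropping of forced strips;
    this is why \<open>A\<close> and \<open>B\<close> of the halved regions agree with
    \<open>top_level\<close> and \<open>bot_level\<close>.\<close>
  have half_y: "2 * int ((y + 1) div 2) = (if even y then int y else int y + 1)"
    "2 * int (y div 2) = (if even y then int y else int y - 1)"
    by presburger+
  have hh: "2 * halved_h y' (c # tl a) b = 2 * int y' + north - int y - int a1 + 2 * int c" for y' c
    by (simp add: halved_h_def o north_def a1_def)
  have hg: "2 * halved_g y' z (c # tl a) b = 2 * int y' + south - int y" for y' c
    by (simp add: halved_g_def e south_def)
  have ta: "entry a 1 = a1" by (simp add: a1_def)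
  show ?thesis
    unfolding ta n_def[symmetric]
  proof (intro conjI impI)
    assume ev: "even a1"
    have c: "2 * int (a1 div 2) = int (entry a 1) + 0" using ev by (auto simp: a1_def)
    have Wev: "even Wd" using ev Wpar by simp
    have "M (half False False, axis_weight) = M (H2 (x div 2) ((y + 1) div 2) z (a1 div 2 # tl a) b)"
      unfolding H2_def Let_def
      by (subst M_half_halved[OF c xy(1), where \<alpha> = "alt 0 1" and \<beta> = "alt 0 1", OF _ _ refl refl])
        (use Wev ev ypar half_y(1) in \<open>auto simp: alt_def zz_def hh hg top_level_def bot_level_def zigzag_weight_empty c ta[simplified]\<close>)
    moreover have "M (half True True, axis_weight) = M (W1 ((x + 1) div 2) (y div 2) z (a1 div 2 # tl a) b)"
      unfolding W1_def Let_def
      by (subst M_half_halved[OF c xy(2), where \<alpha> = "alt 0 (- 1)" and \<beta> = "alt 0 (- 1)", OF _ _ refl refl])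
        (use Wev ev ypar half_y(2) in \<open>auto simp: alt_def zz_def hh hg top_level_def bot_level_def c ta[simplified]\<close>)
    ultimately show "M (S1 x y z a b) = 2 ^ n * M (H2 (x div 2) ((y + 1) div 2) z (a1 div 2 # tl a) b) *
        M (W1 ((x + 1) div 2) (y div 2) z (a1 div 2 # tl a) b)"
      using M_Reg_even[OF ev[unfolded a1_def] n] unfolding S1_eq by (simp add: ac_simps)
  next
    assume od: "odd a1"
    have c1: "2 * int ((a1 + 1) div 2) = int (entry a 1) + 1" using od by (auto simp: a1_def elim: oddE)
    have c2: "2 * int ((a1 - 1) div 2) = int (entry a 1) + (- 1)" using od by (auto simp: a1_def elim: oddE)
    have od2: "2 * int (a1 div 2) = int a1 - 1" using od by (auto elim: oddE)
    have od3: "(a1 - Suc 0) div 2 = a1 div 2" using od by (auto elim: oddE)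
    have Wod: "odd Wd" using od Wpar by simp
    have "M (half False True, axis_weight) = M (N4 (x div 2) ((y + 1) div 2) z ((a1 + 1) div 2 # tl a) b)"
      unfolding N4_def Let_def
      by (subst M_half_halved[OF c1 xy(1), where \<alpha> = "alt 2 1" and \<beta> = "alt 0 1", OF _ _ refl refl])
        (use Wod od od2 ypar half_y(1) in \<open>auto simp: alt_def zz_def hh hg top_level_def bot_level_def c1 ta[simplified]\<close>)
    moreover have "M (half True False, axis_weight) = M (N1 ((x + 1) div 2) (y div 2) z ((a1 - 1) div 2 # tl a) b)"
      unfolding N1_def Let_def
      by (subst M_half_halved[OF c2 xy(2), where \<alpha> = "alt (- 2) (- 1)" and \<beta> = "alt 0 (- 1)", OF _ _ refl refl])
        (use Wod od od2 ypar half_y(2) in \<open>auto simp: od3 alt_def zz_def hh hg top_level_def bot_level_def c2 ta[simplified]\<close>)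
    ultimately show "M (S1 x y z a b) = 2 ^ n * M (N4 (x div 2) ((y + 1) div 2) z ((a1 + 1) div 2 # tl a) b) *
        M (N1 ((x + 1) div 2) (y div 2) z ((a1 - 1) div 2 # tl a) b)"
      using M_Reg_odd[OF od[unfolded a1_def] n] unfolding S1_eq by (simp add: ac_simps)
  qed
qed

end
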